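(* Let $\lambda,\lambda'\ge 2$ be integers, let $\underline{u}=(u_1,\dots,u_r)$, $\underline{v}=(v_1,\dots,v_r)$, $\underline{u}'=(u'_1,\dots,u'_{r'})$, $\underline{v}'=(v'_1,\dots,v'_{r'})$ be vectors of integers $\ge 2$, and put $N=u_1v_1\cdots u_rv_r$, $N'=u'_1v'_1\cdots u'_{r'}v'_{r'}$. Assume that \[ R_{\underline{\lambda}^{(\underline{u})}_{\underline{u},\underline{v}}S^{(\lambda,N)},\,\underline{\lambda}^{(\underline{v})}_{\underline{u},\underline{v}}} = R_{(\underline{\lambda'})^{(\underline{u}')}_{\underline{u}',\underline{v}'}S^{(\lambda',N')},\,(\underline{\lambda'})^{(\underline{v}')}_{\underline{u}',\underline{v}'}} = 1 \qquad (\ast) \] (i.e. both sides represent every $n\in\mathbb{N}$ exactly once) is a non-trivial solution in which $\underline{\lambda}^{(\underline{v})}_{\underline{u},\underline{v}}\neq(1)$ and $(\underline{\lambda'})^{(\underline{v}')}_{\underline{u}',\underline{v}'}\neq(1)$. Then the following statements are equivalent: (i) $\log\lambda$ and $\log\lambda'$ are linearly independent over $\mathbb{Q}$; (ii) $(\ast)$ is a primitive solution; (iii) $(\ast)$ does not arise from the first construction.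
   Context: $\mathbb{N}_m$ denotes the set of multisets $M$ of nonnegative integers in which $0$ has multiplicity $1$ and every positive integer has finite multiplicity. $\mathbb{Z}^+_m$ denotes the set of vectors $\underline{\alpha}=(\alpha_1,\dots,\alpha_s)$ with $1\le\alpha_1\le\dots\le\alpha_s$ positive integers ($s$ not fixed). For a multiset $A=\{a_1,a_2,\dots\}$ and $\underline{\alpha}\in\mathbb{Z}^+_m$, $R_{A,\underline{\alpha}}(n)=|\{(j_1,\dots,j_s): j_i\in\mathbb{Z}^+,\ \sum_{i=1}^s\alpha_i a_{j_i}=n\}|$, and $\underline{\alpha}A$ is the multiset $\alpha_1A+\dots+\alpha_sA$ (so $R_{A,\underline{\alpha}}=R_{B,\underline{\beta}}$ means $\underline{\alpha}A=\underline{\beta}B$). For vectors $\underline{\alpha},\underline{\beta}$, $\underline{\alpha}\,\underline{\beta}$ denotes the ordered Kronecker product $(\alpha_i\beta_j)_{i,j}$ (sorted). A solution is trivial if $(A,\underline{\alpha})=(B,\underline{\beta})$. For an integer $\lambda\ge2$ and $N\in\mathbb{Z}^+$, $S^{(\lambda,N)}=\{\sum_{i\ge0}\delta_i\lambda^{iN}: \delta_i\in\{0,1,\dots,\lambda-1\}\}$ (finite sums). With $P_i=u_1v_1\cdots u_{i-1}v_{i-1}$ (so $P_1=1$), $\underline{\lambda}^{(\underline{u})}_{\underline{u},\underline{v}}=\prod_{i=1}^{r}(1,\lambda^{P_i},\lambda^{2P_i},\dots,\lambda^{(u_i-1)P_i})$ and $\underline{\lambda}^{(\underline{v})}_{\underline{u},\underline{v}}=\prod_{i=1}^{r}(1,\lambda^{P_iu_i},\lambda^{2P_iu_i},\dots,\lambda^{(v_i-1)P_iu_i})$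 (Kronecker products), so that $\underline{\lambda}^{(\underline{u})}_{\underline{u},\underline{v}}\underline{\lambda}^{(\underline{v})}_{\underline{u},\underline{v}}=(1,\lambda,\dots,\lambda^{N-1})$; analogously for $\lambda',\underline{u}',\underline{v}'$, $N'$. A solution of $\underline{\alpha}A=\underline{\beta}B$ (with $A,B\in\mathbb{N}_m$, $\underline{\alpha},\underline{\beta}\in\mathbb{Z}^+_m$) is primitive if whenever $\underline{\alpha}_1,\underline{\alpha}_2,\underline{\beta}_1,\underline{\beta}_2,\underline{\gamma},\underline{\delta}\in\mathbb{Z}^+_m$ and $C,D\in\mathbb{N}_m$ with $|C|,|D|\ge2$ satisfy $A=\underline{\alpha}_1C$, $\underline{\alpha}=\underline{\gamma}\,\underline{\alpha}_2$, $B=\underline{\beta}_1D$, $\underline{\beta}=\underline{\delta}\,\underline{\beta}_2$ and $\underline{\alpha}_1\underline{\alpha}_2=\underline{\beta}_1\underline{\beta}_2$, then $\underline{\alpha}_1=\underline{\beta}_1=\underline{\alpha}_2=\underline{\beta}_2=(1)$. A solution arises from the first construction if there are $\underline{\alpha}_1,\underline{\alpha}_2,\underline{\beta}_1,\underline{\beta}_2\in\mathbb{Z}^+_m$ with $\underline{\alpha}_1\underline{\alpha}_2=\underline{\beta}_1\underline{\beta}_2$, $(\underline{\alpha}_1,\underline{\alpha}_2)\ne(\underline{\beta}_1,\underline{\beta}_2)$, and $C\in\mathbb{N}_m$ such that $A=\underline{\alpha}_1C$, $\underline{\alpha}=\underline{\alpha}_2$, $B=\underline{\beta}_1C$, $\underline{\beta}=\underline{\beta}_2$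 (so that $R_{\underline{\alpha}_1C,\underline{\alpha}_2}=R_{\underline{\beta}_1C,\underline{\beta}_2}$). *)

theory Defs
  imports Complex_Main
begin

(* Multisets of nonnegative integers with finite multiplicities, possibly with infinitely many
   elements, are represented by their multiplicity functions. *)
type_synonym natmset = "nat \<Rightarrow> nat"

definition Nm :: "natmset set" where
  "Nm = {M. M 0 = 1}"

(* The pair (a, k) stands for the k-th copy of a; so occs A plays the role of the index set of
   an enumeration of A, finite or infinite according to whether A is. *)
definition occs :: "natmset \<Rightarrow> (nat \<times> nat) set" where
  "occs M = {(a, k). k < M a}"

definition natmset_of_set :: "nat set \<Rightarrow> natmset" where
  "natmset_of_set X = (\<lambda>n. of_bool (n \<in> X))"

definition Zpm :: "nat list set" where
  "Zpm = {\<alpha>. \<alpha> \<noteq> [] \<and> sorted \<alpha> \<and> (\<forall>x\<in>set \<alpha>. 1 \<le> x)}"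

definition R :: "natmset \<Rightarrow> nat list \<Rightarrow> nat \<Rightarrow> nat" where
  "R A \<alpha> n = card {js. length js = length \<alpha> \<and> set js \<subseteq> occs A \<and>
                       (\<Sum>i<length \<alpha>. \<alpha> ! i * fst (js ! i)) = n}"

(* The multiset sum of the dilates of A by the entries of the vector: the multiplicity of n in it
   is by definition the number of representations counted by R. *)
definition dilsum :: "nat list \<Rightarrow> natmset \<Rightarrow> natmset" where
  "dilsum \<alpha> A = (\<lambda>n. R A \<alpha> n)"

definition kron :: "nat list \<Rightarrow> nat list \<Rightarrow> nat list" where
  "kron \<alpha> \<beta> = sort [x * y. x \<leftarrow> \<alpha>, y \<leftarrow> \<beta>]"

definition kron_list :: "nat list list \<Rightarrow> nat list" where
  "kron_list vs = foldr kron vs [1]"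

definition solution :: "natmset \<Rightarrow> nat list \<Rightarrow> natmset \<Rightarrow> nat list \<Rightarrow> bool" where
  "solution A \<alpha> B \<beta> \<longleftrightarrow>
     A \<in> Nm \<and> B \<in> Nm \<and> \<alpha> \<in> Zpm \<and> \<beta> \<in> Zpm \<and> R A \<alpha> = R B \<beta>"

definition trivial_solution :: "natmset \<Rightarrow> nat list \<Rightarrow> natmset \<Rightarrow> nat list \<Rightarrow> bool" where
  "trivial_solution A \<alpha> B \<beta> \<longleftrightarrow> solution A \<alpha> B \<beta> \<and> (A, \<alpha>) = (B, \<beta>)"

definition at_least_two :: "natmset \<Rightarrow> bool" where
  "at_least_two M \<longleftrightarrow> infinite (occs M) \<or> 2 \<le> card (occs M)"

definition primitive_solution :: "natmset \<Rightarrow> nat list \<Rightarrow> natmset \<Rightarrow> nat list \<Rightarrow> bool" where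
  "primitive_solution A \<alpha> B \<beta> \<longleftrightarrow> solution A \<alpha> B \<beta> \<and>
     (\<forall>\<alpha>1\<in>Zpm. \<forall>\<alpha>2\<in>Zpm. \<forall>\<beta>1\<in>Zpm. \<forall>\<beta>2\<in>Zpm. \<forall>\<gamma>\<in>Zpm. \<forall>\<delta>\<in>Zpm. \<forall>C\<in>Nm. \<forall>D\<in>Nm.
        at_least_two C \<and> at_least_two D \<and>
        A = dilsum \<alpha>1 C \<and> \<alpha> = kron \<gamma> \<alpha>2 \<and> B = dilsum \<beta>1 D \<and> \<beta> = kron \<delta> \<beta>2 \<and>
        kron \<alpha>1 \<alpha>2 = kron \<beta>1 \<beta>2
        \<longrightarrow> \<alpha>1 = [1] \<and> \<beta>1 = [1] \<and> \<alpha>2 = [1] \<and> \<beta>2 = [1])"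

definition first_construction :: "natmset \<Rightarrow> nat list \<Rightarrow> natmset \<Rightarrow> nat list \<Rightarrow> bool" where
  "first_construction A \<alpha> B \<beta> \<longleftrightarrow> solution A \<alpha> B \<beta> \<and>
     (\<exists>\<alpha>1\<in>Zpm. \<exists>\<alpha>2\<in>Zpm. \<exists>\<beta>1\<in>Zpm. \<exists>\<beta>2\<in>Zpm. \<exists>C\<in>Nm.
        kron \<alpha>1 \<alpha>2 = kron \<beta>1 \<beta>2 \<and> (\<alpha>1, \<alpha>2) \<noteq> (\<beta>1, \<beta>2) \<and>
        A = dilsum \<alpha>1 C \<and> \<alpha> = \<alpha>2 \<and> B = dilsum \<beta>1 C \<and> \<beta> = \<beta>2)"

definition digit_set :: "nat \<Rightarrow> nat \<Rightarrow> nat set" where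
  "digit_set l N = {(\<Sum>i<m. d i * l ^ (i * N)) | m d. \<forall>i. d i < l}"

(* List positions start at 0, so P u v i is the product of the first i pairs. *)
definition P :: "nat list \<Rightarrow> nat list \<Rightarrow> nat \<Rightarrow> nat" where
  "P u v i = (\<Prod>j<i. u ! j * v ! j)"

definition lam_u :: "nat \<Rightarrow> nat list \<Rightarrow> nat list \<Rightarrow> nat list" where
  "lam_u l u v = kron_list
     (map (\<lambda>i. map (\<lambda>k. l ^ (k * P u v i)) [0..<u ! i]) [0..<length u])"

definition lam_v :: "nat \<Rightarrow> nat list \<Rightarrow> nat list \<Rightarrow> nat list" where
  "lam_v l u v = kron_list
     (map (\<lambda>i. map (\<lambda>k. l ^ (k * (P u v i * u ! i))) [0..<v ! i]) [0..<length v])"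

(* Linear independence of the pair (family) x, y: in particular it fails for x = y, whereas the
   set {x, y} would then be a singleton. *)
definition rat_lin_indep2 :: "real \<Rightarrow> real \<Rightarrow> bool" where
  "rat_lin_indep2 x y \<longleftrightarrow>
     (\<forall>p q :: rat. of_rat p * x + of_rat q * y = 0 \<longrightarrow> p = 0 \<and> q = 0)"

end

theory Submission
  imports Defs
    "HOL-Computational_Algebra.Computational_Algebra"
begin

text \<open>
  The heart of the matter is that \<open>R C \<Gamma> = 1\<close> forces the entries of \<open>\<Gamma>\<close> to have pairwise commensurable
  logarithms. With \<open>F\<close> the generating function of \<open>C\<close>, the hypothesis reads
  \<open>\<Prod>\<^sub>g F(x\<^sup>g) = 1 / (1 - x)\<close>. If \<open>F = \<Prod>\<^sub>n (1 - x\<^sup>n)\<close> with the \<open>n\<close>-th factor raised to the power \<open>-e(n)\<close>,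
  then \<open>e\<close> is the Dirichlet inverse of \<open>\<Gamma>\<close>. On the other hand \<open>C\<close> is a direct summand of the
  nonnegative integers, and de Bruijn's analysis of such summands shows that the support of \<open>e\<close> is
  totally ordered by divisibility. For a prime \<open>p\<close>, restrict the convolution identity to the elements
  of \<open>\<Gamma>\<close> where \<open>v\<^sub>p / ln\<close> is maximal, and to those where it is minimal: both times the inverse
  is infinitely supported, with bounded ratios between successive elements of the support. Two such
  sequences cannot interlace in a divisibility chain unless the two extreme values agree.

  A decomposition violating primitivity provides, besides powers of \<open>\<lambda>\<close> in \<open>\<alpha>\<close> and of \<open>\<lambda>'\<close> in \<open>\<beta>\<close>, a
  number \<open>w > 1\<close> that is commensurable with both. Conversely, if \<open>\<lambda>\<close> and \<open>\<lambda>'\<close> are powers of \<open>z\<close>, both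
  \<open>\<alpha>\<close> and \<open>\<beta>\<close> can be completed to the same vector \<open>(1, z, \<dots>, z\<^sup>M\<^sup>-\<^sup>1)\<close>, and the set \<open>C\<close> complementary
  to that vector yields the first construction, since \<open>\<alpha>A\<close> determines \<open>A\<close>.
\<close>

subsection \<open>Direct decompositions of the nonnegative integers\<close>

definition tiles :: "nat set \<Rightarrow> nat set \<Rightarrow> bool" where
  "tiles A B \<longleftrightarrow> (\<forall>n. \<exists>!a. a \<le> n \<and> a \<in> A \<and> n - a \<in> B)"

lemma tilesD:
  assumes "tiles A B"
  shows "\<exists>a\<in>A. \<exists>b\<in>B. a + b = n"
    and "a \<in> A \<Longrightarrow> b \<in> B \<Longrightarrow> a' \<in> A \<Longrightarrow> b' \<in> B \<Longrightarrow> a + b = a' + b' \<Longrightarrow> a = a'"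
proof -
  obtain a where "a \<le> n" "a \<in> A" "n - a \<in> B" using assms unfolding tiles_def by blast
  then show "\<exists>a\<in>A. \<exists>b\<in>B. a + b = n" by (metis le_add_diff_inverse)
next
  assume *: "a \<in> A" "b \<in> B" "a' \<in> A" "b' \<in> B" "a + b = a' + b'"
  have "\<exists>!x. x \<le> a + b \<and> x \<in> A \<and> a + b - x \<in> B" using assms unfolding tiles_def by blast
  moreover have "a \<le> a + b \<and> a \<in> A \<and> a + b - a \<in> B" using *(1,2) by simp
  moreover have "a' \<le> a + b \<and> a' \<in> A \<and> a + b - a' \<in> B" unfolding *(5) using *(3,4) by simp
  ultimately show "a = a'" by blast
qed

lemma tilesI:
  assumes "\<And>n. \<exists>a\<in>A. \<exists>b\<in>B. a + b = n"
    and "\<And>a b a' b'. a \<in> A \<Longrightarrow> b \<in> B \<Longrightarrow> a' \<in> A \<Longrightarrow> b' \<in> B \<Longrightarrow> a + b = a' + b' \<Longrightarrow> a = a'"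
  shows "tiles A B"
  unfolding tiles_def
proof
  fix n
  obtain a b where ab: "a \<in> A" "b \<in> B" "a + b = n" using assms(1) by blast
  show "\<exists>!a. a \<le> n \<and> a \<in> A \<and> n - a \<in> B"
  proof (rule ex1I)
    show "a \<le> n \<and> a \<in> A \<and> n - a \<in> B" using ab by auto
    fix x assume x: "x \<le> n \<and> x \<in> A \<and> n - x \<in> B"
    then have "x + (n - x) = a + b" using ab by simp
    then show "x = a" using assms(2) ab x by blast
  qed
qed

text \<open>The first step of de Bruijn's description of the factorizations
  \<open>\<nat> = A + B\<close>; it is iterated on \<open>B/c\<close> and \<open>A/c\<close>, with the roles exchanged.\<close>

lemma tiles_min_divides:
  assumes tiles: "tiles A B"
    and "c \<in> B" "c \<ge> 2" and min: "\<And>b. b \<in> B \<Longrightarrow> b \<noteq> 0 \<Longrightarrow> c \<le> b"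
  shows "(n \<in> B \<longrightarrow> c dvd n) \<and> (n \<in> A \<longleftrightarrow> c * (n div c) \<in> A)"
proof (induction n rule: less_induct)
  case (less n)
  note rep = tilesD(1)[OF tiles] and uniq = tilesD(2)[OF tiles]
  have A0: "0 \<in> A" and B0: "0 \<in> B" using rep[of 0] by auto
  have small: "m \<in> A" if "m < c" for m
    using rep[of m] min that by fastforce
  define k where "k = c * (n div c)"
  define r where "r = n mod c"
  have n: "n = k + r" by (simp add: k_def r_def)
  have rc: "r < c" using \<open>c \<ge> 2\<close> by (simp add: r_def)
  have ck: "c dvd k" by (simp add: k_def)
  show ?case
  proof (cases "r = 0")
    case True
    then show ?thesis using n ck by (simp add: k_def)
  next
    case False
    then have kn: "k < n" using n by simp
    have dv: "c dvd b" if "b \<in> B" "b \<le> k" for b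
      using less.IH[of b] that kn by simp
    have shift: "a + r \<in> A \<longleftrightarrow> a \<in> A" if "c dvd a" "a < k" for a
    proof -
      have "c * ((a + r) div c) = a" using that(1) rc by auto
      then show ?thesis using less.IH[of "a + r"] that n by simp
    qed
    obtain a b where ab: "a \<in> A" "b \<in> B" "a + b = k" using rep by blast
    have ca: "c dvd a" using dv[OF \<open>b \<in> B\<close>] ab ck by (metis dvd_add_left_iff le_add2)
    have nB: "n \<notin> B"
    proof
      assume nB: "n \<in> B"
      consider "b = 0" | "a = 0" | "a < k" "b \<noteq> 0" using ab by fastforce
      then show False
      proof cases
        case 1
        then have "k \<in> A" using ab by simp
        from uniq[OF this \<open>c \<in> B\<close> small[of "c - r"] nB] n rc False have "k = c - r" by simp
        then have "0 < k" "k < c" using rc False by auto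
        with ck show False by (simp add: nat_dvd_not_less)
      next
        case 2
        then have "k \<in> B" using ab by simp
        from uniq[OF small[OF rc] this A0 nB] n False show False by simp
      next
        case 3
        then have "a + r \<in> A" using shift ca ab by simp
        from uniq[OF this \<open>b \<in> B\<close> A0 nB] n False ab show False by simp
      qed
    qed
    moreover have "n \<in> A" if kA: "k \<in> A"
    proof -
      obtain a b where ab: "a \<in> A" "b \<in> B" "a + b = n" using rep by blast
      show ?thesis
      proof (cases "b = 0")
        case True
        then show ?thesis using ab by simp
      next
        case False
        have "b \<noteq> n" using nB ab by blast
        then have "b < n" using ab by simp
        then have cb: "c dvd b" using less.IH ab by blast
        have "b \<le> k"
        proof (rule ccontr)
          assume "\<not> b \<le> k"
          then have "b - k < c" "0 < b - k" using \<open>b < n\<close> n rc by auto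
          moreover have "c dvd b - k" using cb ck by (rule dvd_diff_nat)
          ultimately show False using nat_dvd_not_less[of "b - k" c] by blast
        qed
        then have "(k - b) + r = a" using ab n by simp
        moreover have "c dvd k - b" using cb ck by simp
        ultimately have "k - b \<in> A" using shift[of "k - b"] ab False \<open>b \<le> k\<close> by simp
        from uniq[OF this \<open>b \<in> B\<close> kA B0] \<open>b \<le> k\<close> False show ?thesis by simp
      qed
    qed
    moreover have "k \<in> A" if nA: "n \<in> A"
    proof (cases "b = 0")
      case True
      then show ?thesis using ab by simp
    next
      case bn: False
      then have "a + r \<in> A" using shift ca ab by simp
      from uniq[OF this \<open>b \<in> B\<close> nA B0] ab n bn show ?thesis by simp
    qed
    ultimately show ?thesis unfolding k_def by blast
  qed
qed

subsection \<open>Finite Dirichlet inverses supported on a divisibility chain\<close>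

lemma dirichlet_chain_commensurable:
  fixes G :: "nat set" and w \<epsilon> :: "nat \<Rightarrow> real"
  assumes fin: "finite G" and G1: "1 \<in> G" and G0: "0 \<notin> G"
    and w: "\<And>g. g \<in> G \<Longrightarrow> w g \<noteq> 0"
    and conv: "\<And>k. k \<ge> 1 \<Longrightarrow> (\<Sum>g | g \<in> G \<and> g dvd k. w g * \<epsilon> (k div g)) = of_bool (k = 1)"
    and chain: "\<And>a b. a \<ge> 1 \<Longrightarrow> b \<ge> 1 \<Longrightarrow> \<epsilon> a \<noteq> 0 \<Longrightarrow> \<epsilon> b \<noteq> 0 \<Longrightarrow> a dvd b \<or> b dvd a"
    and p: "prime (p :: nat)" and x: "x \<in> G" and y: "y \<in> G"
  shows "real (multiplicity p x) * ln (real y) = real (multiplicity p y) * ln (real x)"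
proof -
  define S where "S = {m. m \<ge> 1 \<and> \<epsilon> m \<noteq> 0}"
  have S1: "1 \<in> S"
  proof -
    have "{g \<in> G. g dvd (1::nat)} = {1}" using G1 by auto
    then have "w 1 * \<epsilon> 1 = 1" using conv[of 1] by simp
    then show ?thesis by (auto simp: S_def)
  qed
  have cancel: "\<exists>g'\<in>G. \<exists>m'\<in>S. g' \<noteq> g \<and> g' * m' = g * m"
    if "g \<in> G" "m \<in> S" "g * m > 1" for g m
  proof (rule ccontr)
    assume *: "\<not> ?thesis"
    have g0: "g > 0" using that G0 by (auto intro: gr0I)
    have G_pos: "g' > 0" if "g' \<in> G" for g' using that G0 by (auto intro: gr0I)
    have zero: "w g' * \<epsilon> (g * m div g') = 0" if "g' \<in> {g' \<in> G. g' dvd g * m} - {g}" for g'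
    proof -
      have k: "g' * (g * m div g') = g * m" "g * m div g' \<ge> 1"
        using that \<open>m \<in> S\<close> g0 G_pos
        by (auto simp: S_def Suc_le_eq div_greater_zero_iff intro!: Nat.gr0I dvd_imp_le)
      then have "g * m div g' \<notin> S" using * that by blast
      then show ?thesis using k by (simp add: S_def)
    qed
    have "(\<Sum>g' | g' \<in> G \<and> g' dvd g * m. w g' * \<epsilon> (g * m div g')) =
        w g * \<epsilon> (g * m div g) + (\<Sum>g'\<in>{g' \<in> G. g' dvd g * m} - {g}. w g' * \<epsilon> (g * m div g'))"
      using fin that(1) by (intro sum.remove) auto
    also have "\<dots> = w g * \<epsilon> m" using zero g0 by (simp add: sum.neutral)
    finally have "(\<Sum>g' | g' \<in> G \<and> g' dvd g * m. w g' * \<epsilon> (g * m div g')) = w g * \<epsilon> m" .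
    moreover have "(\<Sum>g' | g' \<in> G \<and> g' dvd g * m. w g' * \<epsilon> (g * m div g')) = 0"
    proof -
      have "g * m \<ge> 1" "g * m \<noteq> 1" using that(3) by linarith+
      then show ?thesis by (simp only: conv of_bool_eq)
    qed
    ultimately show False using that w[of g] by (auto simp: S_def)
  qed
  have face: "(\<forall>m\<in>S. \<phi> m \<ge> 0) \<and>
      (\<exists>h::nat. h > 0 \<and> (\<forall>m\<in>S. \<phi> m = 0 \<longrightarrow> (\<exists>m'\<in>S. \<phi> m' = 0 \<and> m < m' \<and> m' \<le> h * m)))"
    if add: "\<And>a b. a \<ge> 1 \<Longrightarrow> b \<ge> 1 \<Longrightarrow> \<phi> (a * b) = \<phi> a + \<phi> b"
      and nn: "\<And>g. g \<in> G \<Longrightarrow> \<phi> g \<ge> 0" and g1: "g1 \<in> G" "g1 > 1" "\<phi> g1 = 0"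
    for \<phi> :: "nat \<Rightarrow> real" and g1
  proof -
    have phi1: "\<phi> 1 = 0" using add[of 1 1] by simp
    have pos: "\<phi> m \<ge> 0" if "m \<in> S" for m
      using that
    proof (induction m rule: less_induct)
      case (less m)
      show ?case
      proof (cases "m = 1")
        case False
        then have "1 * m > 1" using less.prems by (auto simp: S_def)
        from cancel[OF G1 less.prems this] obtain g m' where
          g: "g \<in> G" "m' \<in> S" "g \<noteq> 1" "g * m' = m" by auto
        have "g > 1" using g G0 by (cases g) auto
        moreover have "m' \<ge> 1" using g by (auto simp: S_def)
        ultimately have "m' < m" using g(4) by auto
        then have "\<phi> m' \<ge> 0" using less.IH g by simp
        then show ?thesis using add[of g m'] nn[OF g(1)] \<open>g > 1\<close> \<open>m' \<ge> 1\<close> g(4) by auto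
      qed (use phi1 in simp)
    qed
    define h where "h = Max {g \<in> G. \<phi> g = 0}"
    have finh: "finite {g \<in> G. \<phi> g = 0}" using fin by simp
    have hG: "h \<in> G" "\<phi> h = 0" using Max_in[OF finh] g1 by (auto simp: h_def)
    have hmax: "g \<le> h" if "g \<in> G" "\<phi> g = 0" for g
      using Max_ge[OF finh, of g] that by (auto simp: h_def)
    have h1: "h > 1" using hmax[of g1] g1 by simp
    have "\<exists>m'\<in>S. \<phi> m' = 0 \<and> m < m' \<and> m' \<le> h * m" if m: "m \<in> S" "\<phi> m = 0" for m
    proof -
      have m1: "m \<ge> 1" using m by (auto simp: S_def)
      then have "h * m > 1" using h1 by (metis less_le_trans mult.right_neutral mult_le_mono2)
      from cancel[OF hG(1) m(1) this] obtain g m' where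
        g: "g \<in> G" "m' \<in> S" "g \<noteq> h" "g * m' = h * m" by auto
      have m'1: "m' \<ge> 1" using g by (auto simp: S_def)
      have g1: "g \<ge> 1" using g G0 by (cases g) auto
      have "\<phi> g + \<phi> m' = \<phi> h + \<phi> m"
        using add[OF g1 m'1] add[of h m] m1 h1 g by simp
      then have z: "\<phi> g = 0" "\<phi> m' = 0" using nn[OF g(1)] pos[OF g(2)] hG m by linarith+
      then have "g < h" using hmax[of g] g by simp
      have "m < m'"
      proof (rule ccontr)
        assume "\<not> m < m'"
        then have "g * m' \<le> g * m" by simp
        also have "\<dots> < h * m" using \<open>g < h\<close> m1 by simp
        finally have "g * m' < h * m" .
        then show False using g by simp
      qed
      moreover have "m' \<le> h * m" using g(4) g1 by (metis mult_le_mono1 nat_mult_1)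
      ultimately show ?thesis using z g by blast
    qed
    then show ?thesis using pos h1 by (intro conjI exI[of _ h]) auto
  qed
  define v where "v = (\<lambda>n. real (multiplicity p n))"
  have v_mult: "v (a * b) = v a + v b" if "a \<ge> 1" "b \<ge> 1" for a b
    using that p by (simp add: v_def prime_elem_multiplicity_mult_distrib)
  define \<theta> where "\<theta> = (\<lambda>n. v n / ln (real n))"
  define H where "H = G - {1}"
  have Hgt: "g > 1" if "g \<in> H" for g using that G0 by (cases g) (auto simp: H_def)
  have v1: "v 1 = 0" by (simp add: v_def)
  have theta_eq: "\<theta> x = \<theta> y" if xy: "x \<in> H" "y \<in> H" for x y
  proof -
    have finH: "finite (\<theta> ` H)" "\<theta> ` H \<noteq> {}" using fin xy by (auto simp: H_def)
    define t where "t = Max (\<theta> ` H)"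
    define s where "s = Min (\<theta> ` H)"
    obtain g where g: "g \<in> H" "\<theta> g = t" using Max_in[OF finH] by (auto simp: t_def)
    obtain g' where g': "g' \<in> H" "\<theta> g' = s" using Min_in[OF finH] by (auto simp: s_def)
    have t: "v a \<le> t * ln a" if "a \<in> G" for a
    proof (cases "a = 1")
      case False
      then have "\<theta> a \<le> t" "a > 1" using that finH Hgt[of a] by (auto simp: t_def H_def)
      then show ?thesis by (simp add: \<theta>_def divide_le_eq)
    qed (use v1 in simp)
    have s: "s * ln a \<le> v a" if "a \<in> G" for a
    proof (cases "a = 1")
      case False
      then have "s \<le> \<theta> a" "a > 1" using that finH Hgt[of a] by (auto simp: s_def H_def)
      then show ?thesis by (simp add: \<theta>_def le_divide_eq)
    qed (use v1 in simp)
    have st: "s \<le> t" using finH by (simp add: s_def t_def)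
    have t0: "t \<ge> 0" using g Hgt[OF g(1)] by (auto simp: \<theta>_def v_def)
    have "\<not> s < t"
    proof
      assume lt: "s < t"
      have "t * ln g - v g = 0" using g Hgt[OF g(1)] by (auto simp: \<theta>_def)
      moreover have "t * ln (a * b) - v (a * b) = (t * ln a - v a) + (t * ln b - v b)"
        if "a \<ge> 1" "b \<ge> 1" for a b :: nat
        using that by (simp add: v_mult ln_mult distrib_left)
      moreover have "0 \<le> t * ln a - v a" if "a \<in> G" for a using t[OF that] by simp
      moreover have "g \<in> G" using g by (simp add: H_def)
      ultimately obtain h where
        h: "h > 0" and step1: "\<And>m. m \<in> S \<Longrightarrow> t * ln m - v m = 0 \<Longrightarrow>
             \<exists>m'\<in>S. t * ln m' - v m' = 0 \<and> m < m' \<and> m' \<le> h * m"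
        using face[of "\<lambda>n. t * ln n - v n" g] Hgt[OF g(1)] by blast
      have "v g' - s * ln g' = 0" using g' Hgt[OF g'(1)] by (auto simp: \<theta>_def)
      moreover have "v (a * b) - s * ln (a * b) = (v a - s * ln a) + (v b - s * ln b)"
        if "a \<ge> 1" "b \<ge> 1" for a b :: nat
        using that by (simp add: v_mult ln_mult distrib_left)
      moreover have "0 \<le> v a - s * ln a" if "a \<in> G" for a using s[OF that] by simp
      moreover have "g' \<in> G" using g' by (simp add: H_def)
      ultimately have step2: "\<And>m. m \<in> S \<Longrightarrow> v m - s * ln m = 0 \<Longrightarrow>
             \<exists>m'\<in>S. v m' - s * ln m' = 0 \<and> m < m'"
        using face[of "\<lambda>n. v n - s * ln n" g'] Hgt[OF g'(1)] by blast
      have unb: "\<exists>m\<in>S. v m - s * ln m = 0 \<and> m > K" for K :: nat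
      proof (induction K)
        case 0
        show ?case using S1 v1 by (intro bexI[of _ 1]) auto
      next
        case (Suc K)
        then obtain m where m: "m \<in> S" "v m - s * ln m = 0" "m > K" by blast
        from step2[OF m(1,2)] obtain m' where "m' \<in> S" "v m' - s * ln m' = 0" "m < m'" by blast
        with m(3) show ?case by (intro bexI[of _ m']) auto
      qed
      obtain K :: nat where K: "exp (t * ln h / (t - s)) < K" using reals_Archimedean2 by blast
      obtain n where n: "n \<in> S" "v n = s * ln n" "n > K" using unb[of K] by auto
      define T where "T = {m \<in> S. t * ln m - v m = 0 \<and> m \<le> n}"
      have finT: "finite T" by (rule finite_subset[of _ "{..n}"]) (auto simp: T_def)
      have "1 \<in> T" using S1 v1 n by (auto simp: T_def S_def)
      then have mT: "Max T \<in> T" using Max_in[OF finT] by blast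
      define m where "m = Max T"
      have m: "m \<in> S" "t * ln m = v m" "m \<le> n" using mT by (auto simp: T_def m_def)
      obtain m' where m': "m' \<in> S" "t * ln m' - v m' = 0" "m < m'" "m' \<le> h * m"
        using step1[OF m(1)] m by auto
      have "n < m'"
      proof (rule ccontr)
        assume "\<not> n < m'"
        then have "m' \<in> T" using m' by (auto simp: T_def)
        then show False using Max_ge[OF finT] m'(3) by (fastforce simp: m_def)
      qed
      have n1: "n \<ge> 1" and m1: "m \<ge> 1" using n m by (auto simp: S_def)
      have "m dvd n" using chain[of m n] m n by (auto simp: S_def dest: dvd_imp_le)
      then have "v m \<le> v n" using n1 by (auto simp: v_def intro: dvd_imp_multiplicity_le)
      moreover have "ln n \<le> ln h + ln m"
      proof -
        have "n \<le> h * m" using \<open>n < m'\<close> m'(4) by linarith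
        then have "real n \<le> real (h * m)" by (rule of_nat_mono)
        then have "real n \<le> real h * real m" by simp
        then have "ln n \<le> ln (real h * real m)" using n1 by simp
        also have "ln (real h * real m) = ln h + ln m"
          using h m1 by (simp add: ln_mult)
        finally show ?thesis .
      qed
      then have "t * ln n \<le> t * ln h + t * ln m"
        using mult_left_mono[OF _ t0, of "ln n" "ln h + ln m"] by (simp add: distrib_left)
      ultimately have "(t - s) * ln n \<le> t * ln h" using m n by (simp add: algebra_simps)
      then have "ln n \<le> t * ln h / (t - s)" using lt by (simp add: pos_le_divide_eq mult.commute)
      moreover have "t * ln h / (t - s) < ln n"
      proof -
        have "exp (t * ln h / (t - s)) < real n" using K n(3) by linarith
        also have "real n = exp (ln (real n))" using n1 by simp
        finally show ?thesis by (simp only: exp_less_cancel_iff)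
      qed
      ultimately show False by simp
    qed
    then have "s = t" using st by linarith
    have "\<theta> z = s" if "z \<in> H" for z
    proof (rule order_antisym)
      have z: "\<theta> z \<in> \<theta> ` H" using that by (rule imageI)
      show "\<theta> z \<le> s" unfolding \<open>s = t\<close> t_def by (rule Max_ge[OF finH(1) z])
      show "s \<le> \<theta> z" unfolding s_def by (rule Min_le[OF finH(1) z])
    qed
    from this[OF xy(1)] this[OF xy(2)]
    show ?thesis by (rule trans[OF _ sym])
  qed
  show ?thesis
  proof (cases "x = 1 \<or> y = 1")
    case True
    then show ?thesis by auto
  next
    case False
    then have H: "x \<in> H" "y \<in> H" using x y unfolding H_def by blast+
    have "ln (real x) > 0" "ln (real y) > 0" using Hgt[OF H(1)] Hgt[OF H(2)] by simp_all
    then have "v x * ln (real y) = v y * ln (real x)"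
      using theta_eq[OF H] unfolding \<theta>_def by (simp add: frac_eq_eq)
    then show ?thesis unfolding v_def .
  qed
qed

subsection \<open>Generating functions of dilated sums\<close>

definition gf :: "natmset \<Rightarrow> real fps" where
  "gf A = Abs_fps (\<lambda>n. real (A n))"

definition dilate :: "nat \<Rightarrow> real fps \<Rightarrow> real fps" where
  "dilate a F = F oo fps_X ^ a"

definition ones :: "real fps" where
  "ones = Abs_fps (\<lambda>_. 1)"

lemma gf_nth [simp]: "gf A $ n = real (A n)"
  by (simp add: gf_def)

lemma gf_eq_iff: "gf A = gf B \<longleftrightarrow> A = B"
  by (auto simp: fps_eq_iff fun_eq_iff)

lemma dilate_nth:
  assumes "a \<ge> 1"
  shows "dilate a F $ n = (if a dvd n then F $ (n div a) else 0)"
proof -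
  have "dilate a F $ n = (\<Sum>i=0..n. F $ i * of_bool (n = a * i))"
    unfolding dilate_def fps_compose_nth power_mult[symmetric] fps_X_power_nth
    by (rule sum.cong) auto
  also have "\<dots> = (\<Sum>i=0..n. if i = n div a then if a dvd n then F $ i else 0 else 0)"
  proof (rule sum.cong)
    fix i
    have "n = a * i \<longleftrightarrow> i = n div a \<and> a dvd n" using assms by auto
    then show "F $ i * of_bool (n = a * i) = (if i = n div a then if a dvd n then F $ i else 0 else 0)"
      by auto
  qed simp
  also have "\<dots> = (if a dvd n then F $ (n div a) else 0)"
    by (simp add: sum.delta)
  finally show ?thesis .
qed

lemma dilate_mult: "a \<ge> 1 \<Longrightarrow> dilate a (F * G) = dilate a F * dilate a G"
  by (simp add: dilate_def fps_compose_mult_distrib)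

lemma dilate_prod_mset:
  "a \<ge> 1 \<Longrightarrow> dilate a (\<Prod>x\<in>#M. f x) = (\<Prod>x\<in>#M. dilate a (f x))"
  by (induction M) (auto simp: dilate_mult, simp add: dilate_def)

lemma dilate_dilate: "a \<ge> 1 \<Longrightarrow> b \<ge> 1 \<Longrightarrow> dilate a (dilate b F) = dilate (a * b) F"
  by (auto simp: fps_eq_iff dilate_nth div_mult2_eq elim!: dvdE)

definition reps :: "natmset \<Rightarrow> nat list \<Rightarrow> nat \<Rightarrow> (nat \<times> nat) list set" where
  "reps A \<alpha> n = {js. length js = length \<alpha> \<and> set js \<subseteq> occs A \<and>
                       (\<Sum>i<length \<alpha>. \<alpha> ! i * fst (js ! i)) = n}"

lemma reps_Nil: "reps A [] n = (if n = 0 then {[]} else {})"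
  by (auto simp: reps_def)

lemma reps_Cons:
  "reps A (a # \<alpha>) n = (\<lambda>(p, js). p # js) `
     (SIGMA p : (SIGMA x : {x. a * x \<le> n}. {..<A x}). reps A \<alpha> (n - a * fst p))"
  (is "?L = ?f ` ?S")
proof (intro equalityI subsetI)
  fix js assume "js \<in> ?L"
  then have js: "length js = Suc (length \<alpha>)" "set js \<subseteq> occs A"
    "(\<Sum>i<Suc (length \<alpha>). (a # \<alpha>) ! i * fst (js ! i)) = n"
    by (auto simp: reps_def)
  then obtain p js' where p: "js = p # js'" by (cases js) auto
  have "a * fst p + (\<Sum>i<length \<alpha>. \<alpha> ! i * fst (js' ! i)) = n"
    using js(3) unfolding sum.lessThan_Suc_shift by (simp add: p)
  then have "(p, js') \<in> ?S" using js p by (auto simp: reps_def occs_def)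
  then show "js \<in> ?f ` ?S" using p by force
next
  fix js assume "js \<in> ?f ` ?S"
  then show "js \<in> ?L"
    by (auto simp: reps_def occs_def sum.lessThan_Suc_shift simp del: sum.lessThan_Suc)
qed

lemma finite_mult_le: "a \<ge> 1 \<Longrightarrow> finite {x :: nat. a * x \<le> n}"
  by (rule finite_subset[of _ "{..n}"]) (auto intro: order_trans[rotated])

lemma finite_reps:
  assumes "\<forall>a\<in>set \<alpha>. a \<ge> 1"
  shows "finite (reps A \<alpha> n)"
  using assms
proof (induction \<alpha> arbitrary: n)
  case (Cons a \<alpha>)
  then show ?case
    unfolding reps_Cons by (intro finite_imageI finite_SigmaI finite_mult_le) auto
qed (simp add: reps_Nil)

lemma R_reps: "R A \<alpha> n = card (reps A \<alpha> n)"
  by (simp add: R_def reps_def)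

lemma R_Nil: "R A [] n = of_bool (n = 0)"
  by (simp add: R_reps reps_Nil)

lemma R_Cons:
  assumes "\<forall>a\<in>set (a # \<alpha>). a \<ge> 1"
  shows "R A (a # \<alpha>) n = (\<Sum>x | a * x \<le> n. A x * R A \<alpha> (n - a * x))"
proof -
  have fin: "finite {x. a * x \<le> n}" "\<And>m. finite (reps A \<alpha> m)"
    using assms finite_mult_le finite_reps by auto
  have "R A (a # \<alpha>) n =
      card (SIGMA p : (SIGMA x : {x. a * x \<le> n}. {..<A x}). reps A \<alpha> (n - a * fst p))"
    unfolding R_reps reps_Cons by (rule card_image) (auto simp: inj_on_def)
  also have "\<dots> = (\<Sum>p \<in> (SIGMA x : {x. a * x \<le> n}. {..<A x}). R A \<alpha> (n - a * fst p))"
    using fin by (subst card_SigmaI) (auto simp: R_reps)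
  also have "\<dots> = (\<Sum>x | a * x \<le> n. \<Sum>k<A x. R A \<alpha> (n - a * x))"
    using fin by (subst sum.Sigma) (auto intro: sum.cong)
  finally show ?thesis by simp
qed

lemma gf_dilsum:
  assumes "\<forall>a\<in>set \<alpha>. a \<ge> 1"
  shows "gf (dilsum \<alpha> A) = (\<Prod>a\<in>#mset \<alpha>. dilate a (gf A))"
  using assms
proof (induction \<alpha>)
  case Nil
  show ?case by (auto simp: fps_eq_iff dilsum_def R_Nil)
next
  case (Cons a \<alpha>)
  have a: "a \<ge> 1" using Cons.prems by simp
  have "gf (dilsum (a # \<alpha>) A) $ n = (dilate a (gf A) * gf (dilsum \<alpha> A)) $ n" for n
  proof -
    have "(dilate a (gf A) * gf (dilsum \<alpha> A)) $ n =
        (\<Sum>i\<in>{i\<in>{0..n}. a dvd i}. real (A (i div a) * R A \<alpha> (n - i)))"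
      unfolding fps_mult_nth by (intro sum.mono_neutral_cong_right) (auto simp: dilate_nth[OF a] dilsum_def)
    also have "\<dots> = (\<Sum>x | a * x \<le> n. real (A x * R A \<alpha> (n - a * x)))"
      using a by (intro sum.reindex_bij_witness[of _ "\<lambda>x. a * x" "\<lambda>i. i div a"]) auto
    finally show ?thesis using R_Cons[OF Cons.prems, of A n] by (simp add: dilsum_def)
  qed
  then have "gf (dilsum (a # \<alpha>) A) = dilate a (gf A) * gf (dilsum \<alpha> A)" by (rule fps_ext)
  then show ?case using Cons by simp
qed

text \<open>The coefficients of the logarithmic derivative turn products of dilates into Dirichlet
  convolutions.\<close>

definition ld :: "real fps \<Rightarrow> real fps" where
  "ld F = fps_X * fps_deriv F * inverse F"

lemma ld_mult:
  assumes "F $ 0 \<noteq> 0" "G $ 0 \<noteq> 0"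
  shows "ld (F * G) = ld F + ld G"
proof -
  have "inverse F * F = 1" "inverse G * G = 1" using assms by (simp_all add: inverse_mult_eq_1)
  then show ?thesis
    unfolding ld_def fps_inverse_mult fps_deriv_mult by (simp add: algebra_simps) algebra
qed

lemma ld_prod_mset:
  "(\<And>x. x \<in># M \<Longrightarrow> f x $ 0 \<noteq> 0) \<Longrightarrow> ld (\<Prod>x\<in>#M. f x) = (\<Sum>x\<in>#M. ld (f x))"
proof (induction M)
  case empty
  show ?case by (simp add: ld_def)
next
  case (add x M)
  have "(\<Prod>x\<in>#M. f x) $ 0 \<noteq> 0" using add.prems by (induction M) auto
  then show ?case using add by (simp add: ld_mult)
qed

lemma ld_dilate:
  assumes "a \<ge> 1" "F $ 0 \<noteq> 0"
  shows "ld (dilate a F) = of_nat a * dilate a (ld F)"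
proof -
  have X0: "(fps_X ^ a :: real fps) $ 0 = 0" using assms by simp
  have "fps_X * fps_deriv (fps_X ^ a) = of_nat a * (fps_X ^ a :: real fps)"
    by (auto simp: fps_eq_iff simp flip: fps_of_nat)
  moreover have "dilate a fps_X = fps_X ^ a"
    using X0 by (simp add: dilate_def fps_X_fps_compose_startby0)
  ultimately show ?thesis
    using assms X0 unfolding ld_def dilate_mult[OF assms(1)]
    by (simp add: dilate_def fps_compose_deriv fps_inverse_compose)
qed

lemma ld_ones: "ld ones $ n = of_bool (n \<ge> 1)"
proof -
  have inv: "inverse ones = 1 - fps_X" by (simp add: ones_def fps_inverse_gp')
  have "ones * inverse ones = 1"
    by (rule inverse_mult_eq_1') (simp add: ones_def)
  moreover have "fps_deriv ones = ones\<^sup>2"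
    by (simp add: fps_eq_iff ones_def power2_eq_square fps_mult_nth)
  ultimately have "ld ones = fps_X * ones"
    unfolding ld_def by (simp add: power2_eq_square mult.assoc)
  then show ?thesis by (simp add: ones_def)
qed

subsection \<open>Commensurability of unique representation vectors\<close>

lemma tiles_ld:
  assumes "tiles A B"
  shows "ld (gf (natmset_of_set A)) $ n + ld (gf (natmset_of_set B)) $ n = of_bool (n \<ge> 1)"
proof -
  have "(gf (natmset_of_set A) * gf (natmset_of_set B)) $ n = ones $ n" for n
  proof -
    obtain a b where ab: "a \<in> A" "b \<in> B" "a + b = n" using tilesD(1)[OF assms] by blast
    have "x = a" if "x \<le> n" "x \<in> A" "n - x \<in> B" for x
      by (rule tilesD(2)[OF assms that(2,3) ab(1,2)]) (use that ab in simp)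
    then have "{i \<in> {0..n}. i \<in> A \<and> n - i \<in> B} = {a}" using ab by auto
    moreover have "(gf (natmset_of_set A) * gf (natmset_of_set B)) $ n =
        (\<Sum>i | i \<in> {0..n} \<and> i \<in> A \<and> n - i \<in> B. 1)"
      unfolding fps_mult_nth
      by (intro sum.mono_neutral_cong_right) (auto simp: natmset_of_set_def)
    ultimately show ?thesis by (simp add: ones_def)
  qed
  then have "gf (natmset_of_set A) * gf (natmset_of_set B) = ones" by (simp add: fps_eq_iff)
  moreover have "0 \<in> A" "0 \<in> B" using tilesD(1)[OF assms, of 0] by auto
  ultimately show ?thesis
    using ld_mult[of "gf (natmset_of_set A)" "gf (natmset_of_set B)"] ld_ones[of n]
    by (simp add: natmset_of_set_def)
qed

lemma proper_divisor_bounds: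
  fixes d n :: nat
  assumes "d dvd n" "d \<noteq> n" "1 \<le> n"
  shows "d < n" "1 \<le> d"
  using assms dvd_imp_le[of d n] dvd_pos_nat[of n d] by auto

lemma tiles_support_chain:
  assumes "tiles A B" "1 \<in> A"
    and "\<And>n. n \<ge> 1 \<Longrightarrow> ld (gf (natmset_of_set A)) $ n = (\<Sum>d | d dvd n. \<epsilon> d)"
    and "1 \<le> a" "a \<le> K" "\<epsilon> a \<noteq> 0" "1 \<le> b" "b \<le> K" "\<epsilon> b \<noteq> 0"
  shows "a dvd b \<or> b dvd a"
  using assms
proof (induction K arbitrary: A B \<epsilon> a b rule: less_induct)
  case (less K)
  note tiles = less.prems(1) and A1 = less.prems(2) and Lsum = less.prems(3)
  have B0: "0 \<in> B" and A0: "0 \<in> A" using tilesD(1)[OF tiles, of 0] by auto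
  have \<epsilon>_step: "\<epsilon> n = of_bool (n = 1)"
    if n: "n \<ge> 1" and L: "\<And>m. m \<ge> 1 \<Longrightarrow> m dvd n \<Longrightarrow> ld (gf (natmset_of_set B)) $ m = 0" for n
    using n L
  proof (induction n rule: less_induct)
    case (less n)
    have fin: "finite {d. d dvd n}" using less.prems(1) by simp
    have "1 = (\<Sum>d | d dvd n. \<epsilon> d)"
      using tiles_ld[OF tiles, of n] less.prems(1) less.prems(2)[OF less.prems(1) dvd_refl]
        Lsum[OF less.prems(1)] by simp
    also have "\<dots> = \<epsilon> n + (\<Sum>d\<in>{d. d dvd n} - {n}. \<epsilon> d)"
      using fin by (intro sum.remove) auto
    also have "(\<Sum>d\<in>{d. d dvd n} - {n}. \<epsilon> d) = (\<Sum>d\<in>{d. d dvd n} - {n}. of_bool (d = 1))"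
    proof (rule sum.cong)
      fix d assume d: "d \<in> {d. d dvd n} - {n}"
      then have "d < n" "d \<ge> 1" using less.prems(1) proper_divisor_bounds[of d n] by auto
      then show "\<epsilon> d = of_bool (d = 1)"
        using d by (intro less.IH less.prems(2)) (auto dest: dvd_trans)
    qed simp
    also have "\<dots> = of_bool (n \<noteq> 1)"
      using less.prems fin by (auto simp: of_bool_def sum.delta)
    finally show ?case by (auto simp: of_bool_def split: if_splits)
  qed
  show ?case
  proof (cases "B = {0}")
    case True
    have "gf (natmset_of_set B) = 1"
      by (simp add: True fps_eq_iff natmset_of_set_def)
    then have "ld (gf (natmset_of_set B)) = 0" by (simp add: ld_def)
    then show ?thesis using \<epsilon>_step[of a] \<epsilon>_step[of b] less.prems by auto
  next
    case False
    then have "\<exists>c. c \<in> B \<and> c \<noteq> 0" using B0 by blast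
    define c where "c = (LEAST c. c \<in> B \<and> c \<noteq> 0)"
    have c: "c \<in> B" "c \<noteq> 0" using LeastI_ex[OF \<open>\<exists>c. _\<close>] by (auto simp: c_def)
    have cmin: "c \<le> b" if "b \<in> B" "b \<noteq> 0" for b
      unfolding c_def using that by (intro Least_le) auto
    have "1 \<notin> B" using tilesD(2)[OF tiles A0 _ A1 B0] by fastforce
    then have c2: "c \<ge> 2" using c by (cases "c = 1") auto
    have Bc: "c dvd b" if "b \<in> B" for b
      using tiles_min_divides[OF tiles c(1) c2 cmin] that by blast
    define A' B' where "A' = {q. c * q \<in> A}" and "B' = {q. c * q \<in> B}"
    have tiles': "tiles B' A'"
    proof (rule tilesI)
      fix n
      obtain x y where xy: "x \<in> A" "y \<in> B" "x + y = c * n" using tilesD(1)[OF tiles] by blast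
      then have "c dvd y" "c dvd x" using Bc by (blast, metis Bc dvd_add_left_iff dvd_triv_left)
      then show "\<exists>a\<in>B'. \<exists>b\<in>A'. a + b = n"
        using xy c by (auto simp: A'_def B'_def elim!: dvdE simp flip: distrib_left)
          (metis add.commute mult_left_cancel)
    next
      fix x y x' y' assume *: "x \<in> B'" "y \<in> A'" "x' \<in> B'" "y' \<in> A'" "x + y = x' + y'"
      then have "c * y + c * x = c * y' + c * x'" by (metis add.commute distrib_left)
      then have "c * y = c * y'"
        by (rule tilesD(2)[OF tiles, rotated -1]) (use * in \<open>auto simp: A'_def B'_def\<close>)
      then show "x = x'" using * c by simp
    qed
    have gfB: "gf (natmset_of_set B) = dilate c (gf (natmset_of_set B'))"
      using c2 Bc by (auto simp: fps_eq_iff dilate_nth natmset_of_set_def B'_def elim!: dvdE)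
    have B'0: "0 \<in> B'" using B0 by (simp add: B'_def)
    then have ldB: "ld (gf (natmset_of_set B)) =
        of_nat c * dilate c (ld (gf (natmset_of_set B')))"
      unfolding gfB using c2 by (intro ld_dilate) (auto simp: natmset_of_set_def)
    have ldB_nth: "ld (gf (natmset_of_set B)) $ n =
        (if c dvd n then c * ld (gf (natmset_of_set B')) $ (n div c) else 0)" for n
      unfolding ldB using c2 by (simp add: dilate_nth flip: fps_of_nat)
    have \<epsilon>_nondvd: "\<epsilon> n = of_bool (n = 1)" if "n \<ge> 1" "\<not> c dvd n" for n
      using that by (intro \<epsilon>_step) (auto simp: ldB_nth dest: dvd_trans)
    define \<epsilon>' where "\<epsilon>' = (\<lambda>d. - \<epsilon> (c * d) / c)"
    have \<epsilon>': "ld (gf (natmset_of_set B')) $ m = (\<Sum>d | d dvd m. \<epsilon>' d)" if m: "m \<ge> 1" for m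
    proof -
      have fin: "finite {d. d dvd c * m}" using m c by simp
      have cm: "c * m \<ge> 1" using m c by simp
      have "1 - c * ld (gf (natmset_of_set B')) $ m = (\<Sum>d | d dvd c * m. \<epsilon> d)"
        using tiles_ld[OF tiles, of "c * m"] cm c Lsum[of "c * m"]
        by (simp add: ldB_nth)
      also have "\<dots> = (\<Sum>d | d dvd c * m \<and> c dvd d. \<epsilon> d) + (\<Sum>d | d dvd c * m \<and> \<not> c dvd d. \<epsilon> d)"
        using fin by (subst sum.union_disjoint[symmetric]) (auto intro: sum.cong)
      also have "(\<Sum>d | d dvd c * m \<and> \<not> c dvd d. \<epsilon> d) = (\<Sum>d | d dvd c * m \<and> \<not> c dvd d. of_bool (d = 1))"
        using cm by (intro sum.cong refl \<epsilon>_nondvd) (auto intro!: Suc_leI Nat.gr0I)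
      also have "\<dots> = (\<Sum>d\<in>{1 :: nat}. 1)"
        using fin c2 by (intro sum.mono_neutral_cong_right) auto
      also have "(\<Sum>d | d dvd c * m \<and> c dvd d. \<epsilon> d) = (\<Sum>d | d dvd m. \<epsilon> (c * d))"
        using c by (intro sum.reindex_bij_witness[of _ "\<lambda>d. c * d" "\<lambda>d. d div c"]) auto
      finally have "c * ld (gf (natmset_of_set B')) $ m = - (\<Sum>d | d dvd m. \<epsilon> (c * d))" by simp
      moreover have "(\<Sum>d | d dvd m. \<epsilon>' d) = - (\<Sum>d | d dvd m. \<epsilon> (c * d)) / c"
        by (simp add: \<epsilon>'_def sum_negf sum_divide_distrib)
      moreover have "ld (gf (natmset_of_set B')) $ m = c * ld (gf (natmset_of_set B')) $ m / c"
        using c by simp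
      ultimately show ?thesis by simp
    qed
    have dvd: "c dvd n" if "n \<noteq> 1" "n \<ge> 1" "\<epsilon> n \<noteq> 0" for n
      using \<epsilon>_nondvd[of n] that by auto
    consider "a = 1" | "b = 1" | "c dvd a" "c dvd b"
      using dvd[of a] dvd[of b] less.prems(4-9) by blast
    then show ?thesis
    proof cases
      case 3
      then obtain i j where ij: "a = c * i" "b = c * j" by (auto elim!: dvdE)
      have K: "K div c < K" using less.prems c2 by (intro div_less_dividend) auto
      have "1 \<in> B'" using c by (simp add: B'_def)
      moreover have "i \<le> K div c" "j \<le> K div c"
        using ij less.prems c2 by (auto simp: less_eq_div_iff_mult_less_eq mult.commute)
      moreover have "1 \<le> i" "1 \<le> j" using ij less.prems by (auto intro!: Suc_leI Nat.gr0I)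
      moreover have "\<epsilon>' i \<noteq> 0" "\<epsilon>' j \<noteq> 0" using ij less.prems c by (auto simp: \<epsilon>'_def)
      ultimately have "i dvd j \<or> j dvd i"
        using less.IH[OF K tiles' _ \<epsilon>'] by blast
      then show ?thesis using ij by auto
    qed auto
  qed
qed

text \<open>The Moebius inverse of \<open>L\<close>, computed recursively.\<close>

function divisor_inverse :: "(nat \<Rightarrow> real) \<Rightarrow> nat \<Rightarrow> real" where
  "divisor_inverse L n = L n - (\<Sum>d | d dvd n \<and> d < n. divisor_inverse L d)"
  by auto
termination by (relation "measure snd") auto

declare divisor_inverse.simps [simp del]

lemma ex_divisor_sum:
  fixes L :: "nat \<Rightarrow> real"
  shows "\<exists>\<epsilon>. \<forall>n\<ge>1. L n = (\<Sum>d | d dvd n. \<epsilon> d)"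
proof (intro exI allI impI)
  fix n :: nat assume n: "n \<ge> 1"
  then have "finite {d. d dvd n}" by simp
  moreover have "{d. d dvd n} - {n} = {d. d dvd n \<and> d < n}" using n by (auto dest: dvd_imp_le)
  ultimately have "(\<Sum>d | d dvd n. divisor_inverse L d) =
      divisor_inverse L n + (\<Sum>d | d dvd n \<and> d < n. divisor_inverse L d)"
    using sum.remove[of "{d. d dvd n}" n "divisor_inverse L"] by simp
  then show "L n = (\<Sum>d | d dvd n. divisor_inverse L d)"
    by (simp add: divisor_inverse.simps[of L n])
qed

lemma divisor_sum_convolution:
  fixes w \<epsilon> :: "nat \<Rightarrow> real"
  assumes "finite G" "0 \<notin> G" "n \<ge> 1"
  shows "(\<Sum>g | g \<in> G \<and> g dvd n. w g * (\<Sum>d | d dvd n div g. \<epsilon> d)) =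
         (\<Sum>k | k dvd n. \<Sum>g | g \<in> G \<and> g dvd k. w g * \<epsilon> (k div g))"
proof -
  have pos: "g > 0" if "g \<in> G" for g using assms that by (auto intro: Nat.gr0I)
  have "(\<Sum>g | g \<in> G \<and> g dvd n. w g * (\<Sum>d | d dvd n div g. \<epsilon> d)) =
      (\<Sum>(g, d)\<in>(SIGMA g:{g. g \<in> G \<and> g dvd n}. {d. d dvd n div g}). w g * \<epsilon> d)"
    using assms pos by (subst sum.Sigma[symmetric]) (auto simp: sum_distrib_left elim!: dvdE intro: Nat.gr0I)
  also have "\<dots> = (\<Sum>(k, g)\<in>(SIGMA k:{k. k dvd n}. {g. g \<in> G \<and> g dvd k}). w g * \<epsilon> (k div g))"
    using pos by (intro sum.reindex_bij_witness[of _ "\<lambda>(k, g). (g, k div g)" "\<lambda>(g, d). (g * d, g)"])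
      (auto elim!: dvdE simp: dvd_div_iff_mult)
  also have "\<dots> = (\<Sum>k | k dvd n. \<Sum>g | g \<in> G \<and> g dvd k. w g * \<epsilon> (k div g))"
    using assms by (subst sum.Sigma) auto
  finally show ?thesis .
qed

lemma divisor_sum_eq_1:
  fixes f :: "nat \<Rightarrow> real"
  assumes "\<And>n. n \<ge> 1 \<Longrightarrow> (\<Sum>k | k dvd n. f k) = 1" "n \<ge> 1"
  shows "f n = of_bool (n = 1)"
  using assms(2)
proof (induction n rule: less_induct)
  case (less n)
  have fin: "finite {d. d dvd n}" using less.prems by simp
  have "1 = f n + (\<Sum>d\<in>{d. d dvd n} - {n}. f d)"
    using fin assms(1)[OF less.prems] by (subst sum.remove[symmetric]) auto
  also have "(\<Sum>d\<in>{d. d dvd n} - {n}. f d) = (\<Sum>d\<in>{d. d dvd n} - {n}. of_bool (d = 1))"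
    using less by (intro sum.cong refl less.IH) (use proper_divisor_bounds in auto)
  also have "\<dots> = of_bool (n \<noteq> 1)"
    using less.prems fin by (auto simp: of_bool_def sum.delta)
  finally show ?case by (auto simp: of_bool_def split: if_splits)
qed

lemma R_zero:
  assumes "\<forall>a\<in>set \<alpha>. a \<ge> 1" "A 0 = 1"
  shows "R A \<alpha> 0 = 1"
  using assms
proof (induction \<alpha>)
  case (Cons a \<alpha>)
  then have "{x. a * x \<le> 0} = {0}" by auto
  then show ?case using Cons by (simp add: R_Cons)
qed (simp add: R_Nil)

lemma R_one:
  assumes "\<forall>a\<in>set \<alpha>. a \<ge> 1" "A 0 = 1"
  shows "R A \<alpha> 1 = count (mset \<alpha>) 1 * A 1"
  using assms
proof (induction \<alpha>)
  case (Cons a \<alpha>)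
  show ?case
  proof (cases "a = 1")
    case True
    then have "{x. a * x \<le> 1} = {0, 1}" by auto
    then show ?thesis using Cons True by (simp add: R_Cons R_zero)
  next
    case False
    have "x = 0" if "a * x \<le> 1" for x
    proof (rule ccontr)
      assume "x \<noteq> 0"
      then have "2 * 1 \<le> a * x" using False Cons.prems by (intro mult_le_mono) auto
      then show False using that by simp
    qed
    then have "{x. a * x \<le> 1} = {0}" by auto
    then show ?thesis using Cons False by (simp add: R_Cons)
  qed
qed (simp add: R_Nil)

lemma dilsum_Nm: "\<alpha> \<in> Zpm \<Longrightarrow> A \<in> Nm \<Longrightarrow> dilsum \<alpha> A \<in> Nm"
  using R_zero[of \<alpha> A] by (simp add: Zpm_def Nm_def dilsum_def)

lemma R_one_eq_1D:
  assumes "R A \<alpha> 1 = 1" "A \<in> Nm" "\<alpha> \<in> Zpm"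
  shows "count (mset \<alpha>) 1 = 1" "A 1 = 1"
  using R_one[of \<alpha> A] assms by (simp_all add: Nm_def Zpm_def)

lemma Zpm_Cons_1:
  assumes "\<alpha> \<in> Zpm" "count (mset \<alpha>) 1 = 1"
  obtains rest where "\<alpha> = 1 # rest" "\<forall>a\<in>set rest. a \<ge> 2"
proof -
  have "1 \<in># mset \<alpha>" using assms(2) by (metis count_inI zero_neq_one)
  then have one: "1 \<in> set \<alpha>" by simp
  then obtain a rest where \<alpha>: "\<alpha> = a # rest" by (cases \<alpha>) auto
  then have a1: "a = 1" using assms(1) one by (fastforce simp: Zpm_def)
  moreover have "b \<ge> 2" if "b \<in> set rest" for b
  proof -
    have "1 \<notin> set rest"
      using assms(2) a1 by (simp add: \<alpha> count_eq_zero_iff)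
    then show ?thesis using that assms(1) by (cases "b = 1") (auto simp: Zpm_def \<alpha>)
  qed
  ultimately show thesis using that \<alpha> by blast
qed

lemma sum_mset_eq_sum_count:
  fixes f :: "'a \<Rightarrow> 'b :: comm_semiring_1"
  assumes "finite S" "set_mset M \<subseteq> S"
  shows "(\<Sum>x\<in>#M. f x) = (\<Sum>x\<in>S. of_nat (count M x) * f x)"
  using assms(2)
proof (induction M)
  case (add y M)
  have "(\<Sum>x\<in>S. of_nat (count (add_mset y M) x) * f x) =
      (\<Sum>x\<in>S. of_nat (count M x) * f x + (if x = y then f x else 0))"
    by (intro sum.cong) (auto simp: algebra_simps)
  also have "\<dots> = (\<Sum>x\<in>#M. f x) + f y"
    using add assms(1) by (simp add: sum.distrib sum.delta)
  finally show ?case by (simp add: add.commute)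
qed simp

lemma fps_sum_mset_nth: "(\<Sum>x\<in>#M. f x) $ n = (\<Sum>x\<in>#M. f x $ n)"
  by (induction M) auto

lemma representation_commensurable:
  assumes rep: "\<And>n. R C \<Gamma> n = 1" and C0: "C 0 = 1" and \<Gamma>: "\<Gamma> \<in> Zpm"
    and p: "prime p" and xy: "x \<in> set \<Gamma>" "y \<in> set \<Gamma>"
  shows "real (multiplicity p x) * ln (real y) = real (multiplicity p y) * ln (real x)"
proof -
  have pos: "\<forall>a\<in>set \<Gamma>. a \<ge> 1" using \<Gamma> by (simp add: Zpm_def)
  note unit = R_one_eq_1D[OF rep _ \<Gamma>]
  have C1: "C 1 = 1" using unit C0 by (simp add: Nm_def)
  obtain rest where \<Gamma>_eq: "\<Gamma> = 1 # rest"
    using Zpm_Cons_1[OF \<Gamma>] unit C0 by (auto simp: Nm_def)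
  define Y where "Y = R C rest"
  have Y0: "Y 0 = 1" using pos C0 by (simp add: Y_def \<Gamma>_eq R_zero)
  have sum1: "(\<Sum>x\<le>n. C x * Y (n - x)) = 1" for n
    using rep[of n] pos by (simp add: \<Gamma>_eq R_Cons Y_def atMost_def)
  define A B where "A = {n. C n \<noteq> 0}" and "B = {n. Y n \<noteq> 0}"
  have tiles: "tiles A B"
    unfolding tiles_def
  proof
    fix n
    obtain a where a: "a \<le> n" "C a * Y (n - a) = 1"
      "\<And>b. b \<le> n \<Longrightarrow> a \<noteq> b \<Longrightarrow> C b * Y (n - b) = 0"
      using sum1[of n] by (subst (asm) sum_eq_1_iff) auto
    show "\<exists>!a. a \<le> n \<and> a \<in> A \<and> n - a \<in> B"
    proof (rule ex1I[of _ a])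
      show "a \<le> n \<and> a \<in> A \<and> n - a \<in> B" using a by (auto simp: A_def B_def)
      show "b = a" if "b \<le> n \<and> b \<in> A \<and> n - b \<in> B" for b
        using a(3)[of b] that by (auto simp: A_def B_def)
    qed
  qed
  have "C n \<le> 1" for n
    using member_le_sum[of n "{..n}" "\<lambda>x. C x * Y (n - x)"] sum1[of n] Y0 by simp
  then have C_eq: "C = natmset_of_set A"
    by (force simp: natmset_of_set_def A_def fun_eq_iff le_Suc_eq)
  define L where "L = (\<lambda>n. ld (gf C) $ n)"
  obtain \<epsilon> where \<epsilon>: "\<And>n. n \<ge> 1 \<Longrightarrow> L n = (\<Sum>d | d dvd n. \<epsilon> d)"
    using ex_divisor_sum[of L] by blast
  define w where "w = (\<lambda>g. real (count (mset \<Gamma>) g) * real g)"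
  have "gf (dilsum \<Gamma> C) = ones"
    by (simp add: fps_eq_iff dilsum_def rep ones_def)
  then have prod: "(\<Prod>g\<in>#mset \<Gamma>. dilate g (gf C)) = ones"
    using gf_dilsum[OF pos] by simp
  have F0: "gf C $ 0 \<noteq> 0" by (simp add: C0)
  have d0: "dilate g (gf C) $ 0 \<noteq> 0" if "g \<in># mset \<Gamma>" for g
    using that pos F0 by (simp add: dilate_nth)
  have Lsum: "(\<Sum>g | g \<in> set \<Gamma> \<and> g dvd n. w g * (\<Sum>d | d dvd n div g. \<epsilon> d)) = 1"
    if n: "n \<ge> 1" for n
  proof -
    have "ld ones = (\<Sum>g\<in>#mset \<Gamma>. ld (dilate g (gf C)))"
      unfolding prod[symmetric] by (rule ld_prod_mset) (use d0 in auto)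
    also have "\<dots> = (\<Sum>g\<in>#mset \<Gamma>. of_nat g * dilate g (ld (gf C)))"
      by (intro arg_cong[of _ _ sum_mset] image_mset_cong ld_dilate) (use pos F0 in auto)
    finally have "1 = (\<Sum>g\<in>#mset \<Gamma>. of_nat g * dilate g (ld (gf C))) $ n"
      using ld_ones[of n] n by simp
    also have "\<dots> = (\<Sum>g\<in>#mset \<Gamma>. real g * dilate g (ld (gf C)) $ n)"
      by (simp add: fps_sum_mset_nth flip: fps_of_nat)
    also have "\<dots> = (\<Sum>g\<in>set \<Gamma>. real (count (mset \<Gamma>) g) * (real g * dilate g (ld (gf C)) $ n))"
      by (rule sum_mset_eq_sum_count) auto
    also have "\<dots> = (\<Sum>g | g \<in> set \<Gamma> \<and> g dvd n. w g * (\<Sum>d | d dvd n div g. \<epsilon> d))"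
    proof (rule sum.mono_neutral_cong_right)
      fix g assume g: "g \<in> {g. g \<in> set \<Gamma> \<and> g dvd n}"
      then have "n div g \<ge> 1" using n pos by (auto simp: Suc_le_eq div_greater_zero_iff dvd_imp_le)
      then show "real (count (mset \<Gamma>) g) * (real g * dilate g (ld (gf C)) $ n) =
          w g * (\<Sum>d | d dvd n div g. \<epsilon> d)"
        using g pos \<epsilon>[of "n div g"] by (simp add: w_def dilate_nth L_def)
    qed (use pos in \<open>auto simp: dilate_nth\<close>)
    finally show ?thesis by simp
  qed
  have LA: "ld (gf (natmset_of_set A)) $ n = (\<Sum>d | d dvd n. \<epsilon> d)" if "n \<ge> 1" for n
    using \<epsilon>[OF that] by (simp only: L_def C_eq[symmetric])
  have A1: "1 \<in> A" using C1 by (simp add: A_def)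
  have G0: "0 \<notin> set \<Gamma>" using pos by auto
  show ?thesis
  proof (rule dirichlet_chain_commensurable)
    show "1 \<in> set \<Gamma>" by (simp add: \<Gamma>_eq)
    show "0 \<notin> set \<Gamma>" by fact
    show "w g \<noteq> 0" if "g \<in> set \<Gamma>" for g using that G0 by (cases "g = 0") (auto simp: w_def)
    show "(\<Sum>g | g \<in> set \<Gamma> \<and> g dvd k. w g * \<epsilon> (k div g)) = of_bool (k = 1)" if "k \<ge> 1" for k
      by (rule divisor_sum_eq_1) (use Lsum divisor_sum_convolution[OF _ G0] that in simp_all)
    show "a dvd b \<or> b dvd a" if "a \<ge> 1" "b \<ge> 1" "\<epsilon> a \<noteq> 0" "\<epsilon> b \<noteq> 0" for a b
      by (rule tiles_support_chain[OF tiles A1 LA, where K = "max a b"]) (use that in simp_all)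
  qed (use p xy in simp_all)
qed

subsection \<open>Kronecker products\<close>

definition mset_times :: "nat multiset \<Rightarrow> nat multiset \<Rightarrow> nat multiset" where
  "mset_times M N = (\<Sum>x\<in>#M. image_mset ((*) x) N)"

lemma mset_times_left [simp]:
  "mset_times {#} N = {#}"
  "mset_times (add_mset x M) N = image_mset ((*) x) N + mset_times M N"
  "mset_times (M + M') N = mset_times M N + mset_times M' N"
  by (simp_all add: mset_times_def)

lemma mset_times_right [simp]:
  "mset_times M {#} = {#}"
  "mset_times M (add_mset y N) = image_mset ((*) y) M + mset_times M N"
  "mset_times M (N + N') = mset_times M N + mset_times M N'"
  by (induction M) (simp_all add: mult.commute)

lemma mset_times_commute: "mset_times M N = mset_times N M"
  by (induction M) simp_all

lemma image_mset_times:
  "image_mset ((*) (x * y)) N = image_mset ((*) (x :: nat)) (image_mset ((*) y) N)"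
  "image_mset ((*) (Suc 0)) N = N"
  by (induction N) simp_all

lemma mset_times_image: "mset_times (image_mset ((*) x) M) N = image_mset ((*) x) (mset_times M N)"
  by (induction M) (simp_all add: image_mset_times(1))

lemma mset_times_assoc: "mset_times (mset_times M N) K = mset_times M (mset_times N K)"
  by (induction M) (simp_all add: mset_times_image)

lemma mset_kron: "mset (kron \<alpha> \<beta>) = mset_times (mset \<alpha>) (mset \<beta>)"
  unfolding kron_def by (induction \<alpha>) (simp_all add: mset_map)

lemma set_kron: "set (kron \<alpha> \<beta>) = {x * y | x y. x \<in> set \<alpha> \<and> y \<in> set \<beta>}"
  by (auto simp: kron_def)

lemma kron_memI: "x \<in> set \<alpha> \<Longrightarrow> y \<in> set \<beta> \<Longrightarrow> x * y \<in> set (kron \<alpha> \<beta>)"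
  by (auto simp: set_kron)

lemma kron_eqI: "sorted \<gamma> \<Longrightarrow> mset \<gamma> = mset_times (mset \<alpha>) (mset \<beta>) \<Longrightarrow> kron \<alpha> \<beta> = \<gamma>"
  by (metis kron_def mset_kron mset_sort properties_for_sort)

lemma sorted_kron [simp]: "sorted (kron \<alpha> \<beta>)"
  by (simp add: kron_def)

lemma kron_commute: "kron \<alpha> \<beta> = kron \<beta> \<alpha>"
  by (rule kron_eqI) (simp_all add: mset_kron mset_times_commute)

lemma kron_assoc: "kron (kron \<alpha> \<beta>) \<gamma> = kron \<alpha> (kron \<beta> \<gamma>)"
  by (rule kron_eqI) (simp_all add: mset_kron mset_times_assoc)

lemma kron_left_commute: "kron \<beta> (kron \<alpha> \<gamma>) = kron \<alpha> (kron \<beta> \<gamma>)"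
  by (metis kron_assoc kron_commute)

lemma kron_one: "sorted \<alpha> \<Longrightarrow> kron [Suc 0] \<alpha> = \<alpha>" "sorted \<alpha> \<Longrightarrow> kron \<alpha> [Suc 0] = \<alpha>"
  by (rule kron_eqI; simp add: image_mset_times(2))+

lemma kron_Zpm: "\<alpha> \<in> Zpm \<Longrightarrow> \<beta> \<in> Zpm \<Longrightarrow> kron \<alpha> \<beta> \<in> Zpm"
proof -
  assume *: "\<alpha> \<in> Zpm" "\<beta> \<in> Zpm"
  then obtain a b where "a \<in> set \<alpha>" "b \<in> set \<beta>"
    unfolding Zpm_def by (metis (mono_tags, lifting) last_in_set mem_Collect_eq)
  then have "a * b \<in> set (kron \<alpha> \<beta>)" by (rule kron_memI)
  then have "kron \<alpha> \<beta> \<noteq> []" by auto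
  then show ?thesis using * by (fastforce simp: Zpm_def set_kron)
qed

lemma prod_mset_mset_times:
  "(\<Prod>z\<in>#mset_times M N. f z) = (\<Prod>x\<in>#M. \<Prod>y\<in>#N. f (x * y))"
  by (induction M) (simp_all add: image_mset.compositionality o_def)

lemma dilsum_kron:
  assumes "\<alpha> \<in> Zpm" "\<beta> \<in> Zpm"
  shows "dilsum (kron \<alpha> \<beta>) C = dilsum \<alpha> (dilsum \<beta> C)"
proof -
  have pos: "\<forall>a\<in>set \<alpha>. a \<ge> 1" "\<forall>b\<in>set \<beta>. b \<ge> 1" "\<forall>c\<in>set (kron \<alpha> \<beta>). c \<ge> 1"
    using assms kron_Zpm[OF assms] by (auto simp: Zpm_def)
  have "gf (dilsum (kron \<alpha> \<beta>) C) = (\<Prod>x\<in>#mset \<alpha>. \<Prod>y\<in>#mset \<beta>. dilate (x * y) (gf C))"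
    by (simp add: gf_dilsum[OF pos(3)] mset_kron prod_mset_mset_times)
  also have "\<dots> = (\<Prod>x\<in>#mset \<alpha>. dilate x (gf (dilsum \<beta> C)))"
  proof (intro arg_cong[of _ _ prod_mset] image_mset_cong)
    fix x assume x: "x \<in># mset \<alpha>"
    have "(\<Prod>y\<in>#mset \<beta>. dilate (x * y) (gf C)) = (\<Prod>y\<in>#mset \<beta>. dilate x (dilate y (gf C)))"
      by (intro arg_cong[of _ _ prod_mset] image_mset_cong dilate_dilate[symmetric]) (use x pos in auto)
    also have "\<dots> = dilate x (gf (dilsum \<beta> C))"
      using x pos by (simp add: gf_dilsum dilate_prod_mset)
    finally show "(\<Prod>y\<in>#mset \<beta>. dilate (x * y) (gf C)) = dilate x (gf (dilsum \<beta> C))" .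
  qed
  also have "\<dots> = gf (dilsum \<alpha> (dilsum \<beta> C))" by (simp add: gf_dilsum[OF pos(1)])
  finally show ?thesis by (simp add: gf_eq_iff)
qed

definition geom :: "nat \<Rightarrow> nat \<Rightarrow> nat list" where
  "geom l n = map (\<lambda>k. l ^ k) [0..<n]"

lemma sorted_geom: "l \<ge> 1 \<Longrightarrow> sorted (geom l n)"
  unfolding geom_def sorted_map by (rule sorted_wrt_mono_rel[of _ "(\<le>)"]) (auto intro: power_increasing)

lemma geom_Zpm: "l \<ge> 1 \<Longrightarrow> n \<ge> 1 \<Longrightarrow> geom l n \<in> Zpm"
  by (auto simp: Zpm_def sorted_geom) (auto simp: geom_def)

lemma geom_add: "geom l (m + n) = geom l m @ map ((*) (l ^ m)) (geom l n)"
proof -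
  have "[m..<m + n] = map (\<lambda>i. i + m) [0..<n]" by (simp add: map_add_upt add.commute)
  then show ?thesis
    by (simp add: geom_def upt_add_eq_append[of 0 m n] power_add mult.commute)
qed

lemma kron_geom:
  assumes "l \<ge> 1"
  shows "kron (geom l m) (geom (l ^ m) n) = geom l (m * n)"
proof (rule kron_eqI)
  show "sorted (geom l (m * n))" using assms by (rule sorted_geom)
  show "mset (geom l (m * n)) = mset_times (mset (geom l m)) (mset (geom (l ^ m) n))"
  proof (induction n)
    case (Suc n)
    have "mset (geom (l ^ m) (Suc n)) = add_mset (l ^ (m * n)) (mset (geom (l ^ m) n))"
      by (simp add: geom_def power_mult)
    moreover have "mset (geom l (m * Suc n)) =
        mset (geom l (m * n)) + image_mset ((*) (l ^ (m * n))) (mset (geom l m))"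
      using geom_add[of l "m * n" m] by (simp add: add.commute mset_map)
    ultimately show ?case using Suc by simp
  qed (simp add: geom_def)
qed

lemma kron_list_simps: "kron_list [] = [1]" "kron_list (x # xs) = kron x (kron_list xs)"
  by (simp_all add: kron_list_def)

lemma kron_list_Zpm: "\<forall>x\<in>set xs. x \<in> Zpm \<Longrightarrow> kron_list xs \<in> Zpm"
  by (induction xs) (simp_all add: kron_list_simps kron_Zpm, simp add: Zpm_def)

lemma kron_list_snoc: "sorted x \<Longrightarrow> kron_list (xs @ [x]) = kron (kron_list xs) x"
  by (induction xs) (simp_all add: kron_list_simps kron_one kron_assoc)

lemma kron_kron_list:
  "kron (kron_list (map f xs)) (kron_list (map g xs)) = kron_list (map (\<lambda>i. kron (f i) (g i)) xs)"
proof (induction xs)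
  case Nil
  show ?case by (simp add: kron_list_simps kron_one)
next
  case (Cons x xs)
  then show ?case
    by (simp add: kron_list_simps kron_assoc kron_left_commute[of _ "g x"] flip: Cons.IH)
qed

lemma kron_list_powers:
  assumes "\<forall>x\<in>set xs. \<forall>y\<in>set x. \<exists>k. y = l ^ k" "y \<in> set (kron_list xs)"
  shows "\<exists>k. y = (l :: nat) ^ k"
  using assms
proof (induction xs arbitrary: y)
  case Nil
  then show ?case by (intro exI[of _ 0]) (simp add: kron_list_simps)
next
  case (Cons x xs)
  then obtain a b where "a \<in> set x" "b \<in> set (kron_list xs)" "y = a * b"
    by (auto simp: kron_list_simps set_kron)
  moreover obtain i j where "a = l ^ i" "b = l ^ j"
    using Cons calculation by (metis list.set_intros)
  ultimately show ?case by (metis power_add)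
qed

lemma power_mult_commute: "l ^ (k * p) = ((l :: nat) ^ p) ^ k"
  by (metis mult.commute power_mult)

lemma lam_u_geom:
  "lam_u l u v = kron_list (map (\<lambda>i. geom (l ^ P u v i) (u ! i)) [0..<length u])"
  unfolding lam_u_def geom_def by (simp only: power_mult_commute)

lemma lam_v_geom:
  "lam_v l u v = kron_list (map (\<lambda>i. geom ((l ^ P u v i) ^ (u ! i)) (v ! i)) [0..<length v])"
  unfolding lam_v_def geom_def power_mult[symmetric] power_mult_commute[of l _ "P u v _ * u ! _"] ..

lemma lam_v_powers: "y \<in> set (lam_v l u v) \<Longrightarrow> \<exists>k. y = l ^ k"
  unfolding lam_v_def by (erule kron_list_powers[rotated]) auto

lemma kron_lam:
  assumes "l \<ge> 1" "length u = length v"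
  shows "kron (lam_u l u v) (lam_v l u v) = geom l (\<Prod>i<length u. u ! i * v ! i)"
proof -
  have "kron (lam_u l u v) (lam_v l u v) =
      kron_list (map (\<lambda>i. geom (l ^ P u v i) (u ! i * v ! i)) [0..<length u])"
    unfolding lam_u_geom lam_v_geom assms(2)[symmetric] kron_kron_list
    using assms(1) by (simp add: kron_geom)
  also have "kron_list (map (\<lambda>i. geom (l ^ P u v i) (u ! i * v ! i)) [0..<r]) = geom l (P u v r)" for r
  proof (induction r)
    case 0
    show ?case by (simp add: kron_list_simps geom_def P_def)
  next
    case (Suc r)
    have "P u v (Suc r) = P u v r * (u ! r * v ! r)" by (simp add: P_def)
    then show ?case using Suc assms(1) by (simp add: kron_list_snoc sorted_geom kron_geom)
  qed
  finally show ?thesis by (simp add: P_def)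
qed

subsection \<open>Completion to a geometric vector\<close>

lemma R_cong_half:
  assumes "\<forall>a\<in>set \<alpha>. a \<ge> 2" "\<And>m. 2 * m \<le> n \<Longrightarrow> A m = A' m"
  shows "R A \<alpha> n = R A' \<alpha> n"
  using assms
proof (induction \<alpha> arbitrary: n)
  case (Cons a \<alpha>)
  have pos: "\<forall>b\<in>set (a # \<alpha>). b \<ge> 1" using Cons.prems(1) by fastforce
  have a: "a \<ge> 2" using Cons.prems(1) by simp
  show ?case
    unfolding R_Cons[OF pos]
  proof (rule sum.cong)
    fix x assume "x \<in> {x. a * x \<le> n}"
    then have "a * x \<le> n" by simp
    with mult_le_mono1[OF a] have "2 * x \<le> n" by (rule le_trans)
    then have "A x = A' x" by (rule Cons.prems(2))
    moreover have "R A \<alpha> (n - a * x) = R A' \<alpha> (n - a * x)"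
      using Cons.prems by (intro Cons.IH) auto
    ultimately show "A x * R A \<alpha> (n - a * x) = A' x * R A' \<alpha> (n - a * x)" by simp
  qed simp
qed (simp add: R_Nil)

lemma dilsum_cancel:
  assumes \<alpha>: "\<alpha> \<in> Zpm" "count (mset \<alpha>) 1 = 1" and zero: "A 0 = 1" "A' 0 = 1"
    and eq: "\<And>n. R A \<alpha> n = R A' \<alpha> n"
  shows "A = A'"
proof
  fix n
  obtain rest where rest: "\<alpha> = 1 # rest" "\<forall>a\<in>set rest. a \<ge> 2"
    using Zpm_Cons_1[OF \<alpha>] by blast
  have pos: "\<forall>a\<in>set (1 # rest). a \<ge> 1" "\<forall>a\<in>set rest. a \<ge> 1" using rest by fastforce+
  show "A n = A' n"
  proof (induction n rule: less_induct)
    case (less n)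
    show ?case
    proof (cases "n = 0")
      case False
      have split: "R X \<alpha> n = (\<Sum>x<n. X x * R X rest (n - x)) + X n" if "X 0 = 1" for X
        using that pos R_Cons[OF pos(1), of X n] R_zero[OF pos(2), of X]
        by (simp add: rest lessThan_Suc_atMost[symmetric] atMost_def[symmetric])
      have "(\<Sum>x<n. A x * R A rest (n - x)) = (\<Sum>x<n. A' x * R A' rest (n - x))"
      proof (rule sum.cong)
        fix x assume "x \<in> {..<n}"
        moreover have "R A rest (n - x) = R A' rest (n - x)"
          using rest(2) False by (intro R_cong_half less.IH) auto
        ultimately show "A x * R A rest (n - x) = A' x * R A' rest (n - x)"
          using less.IH by simp
      qed simp
      then show ?thesis using split[of A, OF zero(1)] split[of A', OF zero(2)] eq[of n] by simp
    qed (simp add: zero)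
  qed
qed

text \<open>For \<open>q = m ^ M\<close> this is the indicator function of the integers whose base-\<open>m\<close> digits vanish
  outside the positions divisible by \<open>M\<close>, i.e. of \<open>digit_set m M\<close>.\<close>

function digits_ind :: "nat \<Rightarrow> nat \<Rightarrow> nat \<Rightarrow> nat" where
  "digits_ind m q n = (if n = 0 then 1
     else if q \<ge> 2 \<and> n mod q < m then digits_ind m q (n div q) else 0)"
  by auto
termination by (relation "measure (\<lambda>(m, q, n). n)") auto

declare digits_ind.simps [simp del]

lemma digits_ind_0 [simp]: "digits_ind m q 0 = 1"
  by (simp add: digits_ind.simps)

lemma digits_ind_rec:
  assumes "m \<ge> 1" "q \<ge> 2"
  shows "digits_ind m q n = (if n mod q < m then digits_ind m q (n div q) else 0)"
  using assms by (cases "n = 0") (simp_all add: digits_ind.simps[of m q n])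

lemma gf_digits_ind:
  assumes "m \<ge> 1" "q \<ge> 2" "m \<le> q"
  shows "(1 - fps_X) * gf (digits_ind m q) = (1 - fps_X ^ m) * dilate q (gf (digits_ind m q))"
proof -
  have "gf (digits_ind m q) $ n = ((\<Sum>r<m. fps_X ^ r) * dilate q (gf (digits_ind m q))) $ n" for n
  proof -
    have "((\<Sum>r<m. fps_X ^ r) * dilate q (gf (digits_ind m q))) $ n =
        (\<Sum>r<m. if n < r then 0 else dilate q (gf (digits_ind m q)) $ (n - r))"
      by (simp add: sum_distrib_right fps_sum_nth fps_X_power_mult_nth)
    also have "\<dots> = (\<Sum>r<m. if r = n mod q then real (digits_ind m q (n div q)) else 0)"
    proof (rule sum.cong)
      fix r assume r: "r \<in> {..<m}"
      have *: "r \<le> n \<and> q dvd n - r \<longleftrightarrow> r = n mod q"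
      proof
        assume "r \<le> n \<and> q dvd n - r"
        then obtain k where "n = r + q * k" by (metis dvdE le_add_diff_inverse)
        then show "r = n mod q" using r assms by simp
      qed (auto simp: dvd_minus_mod)
      have "(n - n mod q) div q = n div q" using assms by (simp add: minus_mod_eq_mult_div)
      then show "(if n < r then 0 else dilate q (gf (digits_ind m q)) $ (n - r)) =
          (if r = n mod q then real (digits_ind m q (n div q)) else 0)"
        using * assms by (auto simp: dilate_nth not_less)
    qed simp
    also have "\<dots> = real (digits_ind m q n)"
      unfolding digits_ind_rec[OF assms(1,2), of n] by (simp add: sum.delta)
    finally show ?thesis by simp
  qed
  then have "gf (digits_ind m q) = (\<Sum>r<m. fps_X ^ r) * dilate q (gf (digits_ind m q))"
    by (rule fps_ext)
  then have "(1 - fps_X) * gf (digits_ind m q) =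
      ((1 - fps_X) * (\<Sum>r<m. fps_X ^ r)) * dilate q (gf (digits_ind m q))"
    by (metis mult.assoc)
  then show ?thesis by (simp only: one_diff_power_eq)
qed

lemma dilate_one_minus_X: "a \<ge> 1 \<Longrightarrow> dilate a (1 - fps_X ^ b) = 1 - fps_X ^ (a * b)"
  by (auto simp: fps_eq_iff dilate_nth)

lemma mset_geom_Suc: "mset (geom l (Suc n)) = add_mset (l ^ n) (mset (geom l n))"
  by (simp add: geom_def del: mset_upt)

lemma ex_geom_complement:
  assumes m: "m \<ge> 2" and M: "M \<ge> 1"
  shows "\<exists>C. C 0 = 1 \<and> (\<forall>n. R C (geom m M) n = 1)"
proof -
  define q where "q = m ^ M"
  have q: "m \<le> q" using m M by (simp add: q_def self_le_power)
  define F where "F = gf (digits_ind m q)"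
  define g where "g = (\<lambda>j. \<Prod>a\<in>#mset (geom m j). dilate a F)"
  have g_Suc: "g (Suc j) = dilate (m ^ j) F * g j" for j
    by (simp add: g_def mset_geom_Suc)
  have telescope: "(1 - fps_X) * g j = (1 - fps_X ^ (m ^ j)) * dilate q (g j)" for j
  proof (induction j)
    case 0
    have "dilate q 1 = 1" by (simp add: dilate_def)
    then show ?case by (simp add: g_def geom_def)
  next
    case (Suc j)
    have mj: "m ^ j \<ge> 1" using m by simp
    have "dilate (m ^ j) ((1 - fps_X ^ 1) * F) = dilate (m ^ j) ((1 - fps_X ^ m) * dilate q F)"
      using gf_digits_ind[of m q] m q by (simp add: F_def)
    then have step: "(1 - fps_X ^ (m ^ j)) * dilate (m ^ j) F =
        (1 - fps_X ^ (m ^ Suc j)) * dilate q (dilate (m ^ j) F)"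
      using mj m q unfolding dilate_mult[OF mj] dilate_one_minus_X[OF mj]
      by (simp add: dilate_dilate mult.commute)
    have "(1 - fps_X) * g (Suc j) = dilate (m ^ j) F * ((1 - fps_X) * g j)"
      by (simp add: g_Suc mult_ac)
    also have "\<dots> = ((1 - fps_X ^ (m ^ j)) * dilate (m ^ j) F) * dilate q (g j)"
      unfolding Suc by (simp only: mult_ac)
    also have "\<dots> = (1 - fps_X ^ (m ^ Suc j)) * dilate q (g (Suc j))"
      unfolding step g_Suc using m q by (simp only: dilate_mult mult_ac)
    finally show ?case .
  qed
  have h: "(1 - fps_X) * g M = dilate q ((1 - fps_X) * g M)"
  proof -
    have "dilate q ((1 - fps_X) * g M) = (1 - fps_X ^ q) * dilate q (g M)"
      using m q dilate_one_minus_X[of q 1] by (simp add: dilate_mult)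
    then show ?thesis by (rule trans[OF telescope[of M, folded q_def] sym])
  qed
  have pos: "\<forall>a\<in>set (geom m M). a \<ge> 1" using m by (auto simp: geom_def)
  have g_eq: "g M = gf (dilsum (geom m M) (digits_ind m q))"
    unfolding g_def F_def by (rule gf_dilsum[OF pos, symmetric])
  then have g0: "g M $ 0 = 1" using R_zero[OF pos] by (simp add: dilsum_def)
  have "((1 - fps_X) * g M) $ n = of_bool (n = 0)" for n :: nat
  proof (induction n rule: less_induct)
    case (less n)
    show ?case
    proof (cases "n = 0")
      case False
      have "((1 - fps_X) * g M) $ n = (if q dvd n then ((1 - fps_X) * g M) $ (n div q) else 0)"
        by (subst h, rule dilate_nth) (use m q in simp)
      also have "\<dots> = 0"
        using False m q less[of "n div q"] by (auto elim!: dvdE)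
      finally show ?thesis using False by simp
    qed (simp add: g0 fps_mult_nth_0)
  qed
  then have "(1 - fps_X) * g M = 1" by (simp add: fps_eq_iff)
  moreover have "(1 - fps_X) * ones = 1"
    using inverse_mult_eq_1[of ones] by (simp add: ones_def fps_inverse_gp')
  ultimately have "ones = g M" by (metis mult.assoc mult.commute mult_1)
  then have "ones $ n = gf (dilsum (geom m M) (digits_ind m q)) $ n" for n
    by (simp only: g_eq)
  then have "\<forall>n. R (digits_ind m q) (geom m M) n = 1"
    by (simp add: ones_def dilsum_def)
  then show ?thesis by (intro exI[of _ "digits_ind m q"]) simp
qed

lemma log_dependent_common_base:
  assumes l: "l \<ge> 2" and l': "l' \<ge> 2" and dep: "\<not> rat_lin_indep2 (ln (real l)) (ln (real l'))"
  obtains z i j where "z \<ge> 2" "i \<ge> 1" "j \<ge> 1" "l = z ^ i" "l' = z ^ j"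
proof -
  have pos: "ln (real l) > 0" "ln (real l') > 0" using l l' by simp_all
  obtain p q :: rat where pq: "of_rat p * ln (real l) + of_rat q * ln (real l') = 0" "p \<noteq> 0 \<or> q \<noteq> 0"
    using dep unfolding rat_lin_indep2_def by blast
  have "p \<noteq> 0" using pq pos by auto
  then have "ln (real l) / ln (real l') = of_rat (- q / p)"
    using pq pos by (simp add: of_rat_divide of_rat_minus field_simps)
  then have "ln (real l) / ln (real l') \<in> \<rat>" by simp
  then obtain m n :: nat where mn: "n \<noteq> 0" "\<bar>ln (real l) / ln (real l')\<bar> = m / n" "coprime m n"
    using pos by (elim Rats_abs_nat_div_natE)
  then have "ln (real l) / ln (real l') = m / n" using pos by simp
  then have eq: "n * ln (real l) = m * ln (real l')" using pos mn by (simp add: field_simps)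
  then have "m \<noteq> 0" using mn pos by (intro notI) simp
  have "ln (real (l ^ n)) = ln (real (l' ^ m))" using eq l l' by (simp add: ln_realpow)
  then have "real (l ^ n) = real (l' ^ m)" using l l' by (subst (asm) ln_inj_iff) simp_all
  then have pow: "l ^ n = l' ^ m" by (rule of_nat_eq_iff[THEN iffD1])
  have "m > 0" using \<open>m \<noteq> 0\<close> by simp
  have "is_nth_power m l"
    unfolding is_nth_power_conv_multiplicity_nat[OF \<open>m > 0\<close>]
  proof (intro allI impI)
    fix r :: nat assume r: "prime r"
    have "n * multiplicity r l = m * multiplicity r l'"
      using arg_cong[OF pow, of "multiplicity r"] r l l'
      by (simp add: prime_elem_multiplicity_power_distrib)
    then have "m dvd n * multiplicity r l" by simp
    then show "m dvd multiplicity r l" using mn(3) by (simp add: coprime_dvd_mult_right_iff)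
  qed
  then obtain z where z: "l = z ^ m" by (elim is_nth_powerE)
  have "(z ^ n) ^ m = l' ^ m" using pow by (simp add: z mult.commute flip: power_mult)
  then have "l' = z ^ n" using \<open>m \<noteq> 0\<close> by (simp add: power_eq_iff_eq_base)
  moreover have "z \<ge> 2"
  proof (rule ccontr)
    assume "\<not> z \<ge> 2"
    then have "z = 0 \<or> z = 1" by auto
    then show False using l z \<open>m \<noteq> 0\<close> by (auto simp: power_0_left)
  qed
  ultimately show thesis using that[of z m n] z \<open>m \<noteq> 0\<close> mn(1) by simp
qed

subsection \<open>Primitivity and the first construction\<close>

lemma factor_commensurable:
  assumes rep: "\<And>n. R A \<alpha> n = 1" and A: "A \<in> Nm" "A = dilsum \<alpha>1 C" and C: "C \<in> Nm"
    and \<alpha>: "\<alpha> \<in> Zpm" "\<alpha> = kron \<gamma> \<alpha>2" "\<alpha> \<noteq> [1]"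
    and Zpm: "\<gamma> \<in> Zpm" "\<alpha>1 \<in> Zpm" "\<alpha>2 \<in> Zpm"
    and l: "l \<ge> 2" "\<forall>x\<in>set \<alpha>. \<exists>k. x = l ^ k"
  shows "count (mset \<alpha>1) 1 = 1" and "count (mset \<alpha>2) 1 = 1"
    and "\<And>p w. prime p \<Longrightarrow> w \<in> set (kron \<alpha>1 \<alpha>2) \<Longrightarrow>
           real (multiplicity p w) * ln (real l) = real (multiplicity p l) * ln (real w)"
proof -
  have A1: "A 1 = 1" and count_\<alpha>: "count (mset \<alpha>) 1 = 1"
    using R_one_eq_1D[OF rep A(1) \<alpha>(1)] by simp_all
  have "R C \<alpha>1 1 = 1" using A1 A(2) by (simp add: dilsum_def)
  then show c1: "count (mset \<alpha>1) 1 = 1" by (rule R_one_eq_1D(1)) fact+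
  have "R (dilsum \<alpha>2 A) \<gamma> 1 = 1"
    using rep[of 1] dilsum_kron[OF Zpm(1,3), of A] by (simp add: \<alpha>(2) dilsum_def fun_eq_iff)
  note unit = R_one_eq_1D[OF this dilsum_Nm[OF Zpm(3) A(1)] Zpm(1)]
  have c\<gamma>: "count (mset \<gamma>) 1 = 1" by (rule unit(1))
  have "R A \<alpha>2 1 = 1" using unit(2) by (simp add: dilsum_def)
  then show c2: "count (mset \<alpha>2) 1 = 1" by (rule R_one_eq_1D(1)) fact+
  fix p w :: nat assume p: "prime p" and w: "w \<in> set (kron \<alpha>1 \<alpha>2)"
  have one: "1 \<in> set \<beta>" if "count (mset \<beta>) 1 = 1" for \<beta> :: "nat list"
    using that by (metis count_inI set_mset_mset zero_neq_one)
  define \<Gamma> where "\<Gamma> = kron \<alpha> \<alpha>1"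
  have \<Gamma>: "\<Gamma> \<in> Zpm" using \<alpha>(1) Zpm(2) by (simp add: \<Gamma>_def kron_Zpm)
  have rep\<Gamma>: "R C \<Gamma> n = 1" for n
    using rep[of n] dilsum_kron[OF \<alpha>(1) Zpm(2), of C] by (simp add: \<Gamma>_def A(2) dilsum_def fun_eq_iff)
  obtain x y where xy: "x \<in> set \<alpha>1" "y \<in> set \<alpha>2" "w = x * y" using w by (auto simp: set_kron)
  have "1 * y \<in> set \<alpha>" unfolding \<alpha>(2) by (rule kron_memI[OF one[OF c\<gamma>] xy(2)])
  then have "y * x \<in> set \<Gamma>" unfolding \<Gamma>_def using xy(1) by (intro kron_memI) simp_all
  then have w\<Gamma>: "w \<in> set \<Gamma>" by (simp add: xy(3) mult.commute)
  obtain rest where rest: "\<alpha> = 1 # rest" "\<forall>a\<in>set rest. a \<ge> 2"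
    using Zpm_Cons_1[OF \<alpha>(1) count_\<alpha>] by blast
  then obtain b where b: "b \<in> set \<alpha>" "b \<ge> 2" using \<alpha>(3) by (cases rest) auto
  then obtain k where k: "b = l ^ k" using l(2) by blast
  have "k \<noteq> 0" using b k by (intro notI) simp
  have "b * 1 \<in> set \<Gamma>" unfolding \<Gamma>_def by (rule kron_memI[OF b(1) one[OF c1]])
  then have "real (multiplicity p w) * ln (real b) = real (multiplicity p b) * ln (real w)"
    using representation_commensurable[OF rep\<Gamma> _ \<Gamma> p w\<Gamma>, of b] C by (simp add: Nm_def)
  then show "real (multiplicity p w) * ln (real l) = real (multiplicity p l) * ln (real w)"
    using p l(1) \<open>k \<noteq> 0\<close> by (simp add: k ln_realpow prime_elem_multiplicity_power_distrib)
qed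

lemma extend_lam_to_geom:
  assumes z: "z \<ge> 2" "l = z ^ i" "i \<ge> 1" and len: "length u = length v"
    and N: "N = (\<Prod>j<length u. u ! j * v ! j)" "N \<ge> 1" and "K \<ge> 1"
    and lam: "lam_u l u v \<in> Zpm"
  shows "\<exists>\<alpha>1\<in>Zpm. kron \<alpha>1 (lam_v l u v) = geom z (i * N * K)"
proof
  let ?\<alpha>1 = "kron (geom (z ^ (i * N)) K) (kron (geom z i) (lam_u l u v))"
  have z1: "z ^ m \<ge> 1" for m using z by simp
  show "?\<alpha>1 \<in> Zpm"
    using z1[of 1] z1 assms by (intro kron_Zpm geom_Zpm lam) auto
  have "kron ?\<alpha>1 (lam_v l u v) =
      kron (kron (geom z i) (kron (lam_u l u v) (lam_v l u v))) (geom (z ^ (i * N)) K)"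
    by (metis kron_assoc kron_commute)
  also have "kron (lam_u l u v) (lam_v l u v) = geom (z ^ i) N"
    using kron_lam[OF _ len, of l] z N z1[of i] by simp
  finally show "kron ?\<alpha>1 (lam_v l u v) = geom z (i * N * K)"
    using z by (simp add: kron_geom)
qed

lemma lam_u_Zpm:
  assumes "l \<ge> 1" "\<forall>x\<in>set u. x \<ge> 1"
  shows "lam_u l u v \<in> Zpm"
  unfolding lam_u_geom using assms by (intro kron_list_Zpm) (auto intro!: geom_Zpm)

lemma kron_eq_ones:
  assumes "\<alpha> \<in> Zpm" "\<beta> \<in> Zpm" "count (mset \<alpha>) 1 = 1" "count (mset \<beta>) 1 = 1"
    and ones: "\<forall>w\<in>set (kron \<alpha> \<beta>). w = 1"
  shows "\<alpha> = [1]" "\<beta> = [1]"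
proof -
  obtain as where as: "\<alpha> = 1 # as" "\<forall>a\<in>set as. a \<ge> 2"
    using Zpm_Cons_1[OF assms(1,3)] by blast
  obtain bs where bs: "\<beta> = 1 # bs" "\<forall>b\<in>set bs. b \<ge> 2"
    using Zpm_Cons_1[OF assms(2,4)] by blast
  have "\<forall>x\<in>set as. x = 1"
    using bspec[OF ones kron_memI[of _ \<alpha> 1 \<beta>]] by (simp add: as(1) bs(1))
  then show "\<alpha> = [1]" using as by (cases as) auto
  have "\<forall>y\<in>set bs. y = 1"
    using bspec[OF ones kron_memI[of 1 \<alpha> _ \<beta>]] by (simp add: as(1) bs(1))
  then show "\<beta> = [1]" using bs by (cases bs) auto
qed

lemma prod_nth_ge_1:
  fixes u v :: "nat list"
  assumes "length u = length v" "\<forall>x\<in>set u. x \<ge> 1" "\<forall>x\<in>set v. x \<ge> 1"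
  shows "(\<Prod>i<length u. u ! i * v ! i) \<ge> 1"
proof (rule prod_ge_1)
  fix i assume "i \<in> {..<length u}"
  then have "u ! i \<in> set u" "v ! i \<in> set v" using assms(1) by simp_all
  then have "u ! i \<ge> 1" "v ! i \<ge> 1" using assms(2,3) by blast+
  then show "u ! i * v ! i \<ge> 1" by simp
qed

theorem theorem1p14:
  fixes l l' N N' :: nat and u v u' v' :: "nat list"
    and A B :: natmset and \<alpha> \<beta> :: "nat list"
  assumes "l \<ge> 2" and "l' \<ge> 2"
    and "length u = length v" and "length u' = length v'"
    and "\<forall>x\<in>set u. x \<ge> 2" and "\<forall>x\<in>set v. x \<ge> 2"
    and "\<forall>x\<in>set u'. x \<ge> 2" and "\<forall>x\<in>set v'. x \<ge> 2"
    and "N = (\<Prod>i<length u. u ! i * v ! i)"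
    and "N' = (\<Prod>i<length u'. u' ! i * v' ! i)"
    and "A = dilsum (lam_u l u v) (natmset_of_set (digit_set l N))"
    and "\<alpha> = lam_v l u v"
    and "B = dilsum (lam_u l' u' v') (natmset_of_set (digit_set l' N'))"
    and "\<beta> = lam_v l' u' v'"
    and "\<forall>n. R A \<alpha> n = 1" and "\<forall>n. R B \<beta> n = 1"
    and "solution A \<alpha> B \<beta>" and "\<not> trivial_solution A \<alpha> B \<beta>"
    and "\<alpha> \<noteq> [1]" and "\<beta> \<noteq> [1]"
  shows "(rat_lin_indep2 (ln (real l)) (ln (real l')) \<longleftrightarrow> primitive_solution A \<alpha> B \<beta>) \<and>
         (primitive_solution A \<alpha> B \<beta> \<longleftrightarrow> \<not> first_construction A \<alpha> B \<beta>)"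
proof -
  note l = assms(1) and l' = assms(2)
  have repA: "R A \<alpha> n = 1" and repB: "R B \<beta> n = 1" for n
    using assms(15,16) by blast+
  have Nm: "A \<in> Nm" "B \<in> Nm" and Zpm: "\<alpha> \<in> Zpm" "\<beta> \<in> Zpm"
    using assms(17) by (simp_all add: solution_def)
  have pow_\<alpha>: "\<forall>x\<in>set \<alpha>. \<exists>k. x = l ^ k" and pow_\<beta>: "\<forall>x\<in>set \<beta>. \<exists>k. x = l' ^ k"
    using lam_v_powers by (simp_all add: assms(12,14))
  have i_ii: "primitive_solution A \<alpha> B \<beta>" if indep: "rat_lin_indep2 (ln (real l)) (ln (real l'))"
    unfolding primitive_solution_def
  proof (intro conjI ballI impI, fact assms(17))
    fix \<alpha>1 \<alpha>2 \<beta>1 \<beta>2 \<gamma> \<delta> C D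
    assume Z: "\<alpha>1 \<in> Zpm" "\<alpha>2 \<in> Zpm" "\<beta>1 \<in> Zpm" "\<beta>2 \<in> Zpm" "\<gamma> \<in> Zpm" "\<delta> \<in> Zpm" "C \<in> Nm" "D \<in> Nm"
      and *: "at_least_two C \<and> at_least_two D \<and> A = dilsum \<alpha>1 C \<and> \<alpha> = kron \<gamma> \<alpha>2 \<and>
        B = dilsum \<beta>1 D \<and> \<beta> = kron \<delta> \<beta>2 \<and> kron \<alpha>1 \<alpha>2 = kron \<beta>1 \<beta>2"
    then have eqs: "A = dilsum \<alpha>1 C" "\<alpha> = kron \<gamma> \<alpha>2" "B = dilsum \<beta>1 D" "\<beta> = kron \<delta> \<beta>2"
      "kron \<alpha>1 \<alpha>2 = kron \<beta>1 \<beta>2" by blast+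
    note fA = factor_commensurable[OF repA Nm(1) eqs(1) Z(7) Zpm(1) eqs(2) assms(19) Z(5,1,2) l pow_\<alpha>]
    note fB = factor_commensurable[OF repB Nm(2) eqs(3) Z(8) Zpm(2) eqs(4) assms(20) Z(6,3,4) l' pow_\<beta>]
    have one: "\<forall>w\<in>set (kron \<alpha>1 \<alpha>2). w = 1"
    proof (rule ballI, rule ccontr)
      fix w assume w: "w \<in> set (kron \<alpha>1 \<alpha>2)"
      assume "w \<noteq> 1"
      moreover have "w \<ge> 1" using w kron_Zpm[OF Z(1,2)] by (simp add: Zpm_def)
      ultimately obtain p where p: "prime p" "p dvd w" using prime_factor_nat by blast
      define vw vl vl' where "vw = multiplicity p w" and "vl = multiplicity p l"
        and "vl' = multiplicity p l'"
      have vw: "vw > 0" using p \<open>w \<ge> 1\<close> by (simp add: vw_def prime_multiplicity_gt_zero_iff)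
      have 1: "vw * ln (real l) = vl * ln (real w)"
        using fA(3)[OF p(1) w] by (simp add: vw_def vl_def)
      have 2: "vw * ln (real l') = vl' * ln (real w)"
        using fB(3)[OF p(1)] w eqs(5) by (simp add: vw_def vl'_def)
      have "vw * (vl' * ln (real l)) = vl' * (vw * ln (real l))" by simp
      also have "\<dots> = vl * (vl' * ln (real w))" unfolding 1 by simp
      also have "\<dots> = vw * (vl * ln (real l'))" unfolding 2[symmetric] by simp
      finally have "vl' * ln (real l) = vl * ln (real l')" using vw by simp
      then have "of_rat (of_nat vl') * ln (real l) + of_rat (- of_nat vl) * ln (real l') = 0"
        by (simp add: of_rat_minus)
      then have "vl = 0" using indep unfolding rat_lin_indep2_def by fastforce
      then show False using 1 vw l by simp
    qed
    show "\<alpha>1 = [1]" "\<alpha>2 = [1]" by (fact kron_eq_ones[OF Z(1,2) fA(1,2) one])+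
    show "\<beta>1 = [1]" "\<beta>2 = [1]" by (fact kron_eq_ones[OF Z(3,4) fB(1,2) one[unfolded eqs(5)]])+
  qed
  have ii_iii: "\<not> first_construction A \<alpha> B \<beta>" if prim: "primitive_solution A \<alpha> B \<beta>"
  proof
    assume "first_construction A \<alpha> B \<beta>"
    then obtain \<alpha>1 \<beta>1 C where *: "\<alpha>1 \<in> Zpm" "\<beta>1 \<in> Zpm" "C \<in> Nm"
      "kron \<alpha>1 \<alpha> = kron \<beta>1 \<beta>" "A = dilsum \<alpha>1 C" "B = dilsum \<beta>1 C"
      unfolding first_construction_def by blast
    have "A 1 = 1" by (rule R_one_eq_1D(2)[OF repA Nm(1) Zpm(1)])
    then have "R C \<alpha>1 1 = 1" using *(5) by (simp add: dilsum_def)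
    then have "C 1 = 1" by (rule R_one_eq_1D(2)[OF _ *(3,1)])
    then have sub: "{(0, 0), (1, 0)} \<subseteq> occs C" using *(3) by (auto simp: occs_def Nm_def)
    have two: "at_least_two C"
      using card_mono[OF _ sub] by (auto simp: at_least_two_def)
    have "[1] \<in> Zpm" by (simp add: Zpm_def)
    moreover have "\<alpha> = kron [1] \<alpha>" "\<beta> = kron [1] \<beta>"
      using Zpm kron_one by (simp_all add: Zpm_def)
    ultimately have "\<alpha> = [1]"
      using prim * Zpm two unfolding primitive_solution_def by blast
    then show False using assms(19) by simp
  qed
  have iii_i: "first_construction A \<alpha> B \<beta>" if dep: "\<not> rat_lin_indep2 (ln (real l)) (ln (real l'))"
  proof -
    obtain z i j where z: "z \<ge> 2" "i \<ge> 1" "j \<ge> 1" "l = z ^ i" "l' = z ^ j"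
      using log_dependent_common_base[OF l l' dep] by blast
    have ge_1: "\<forall>x\<in>set u. x \<ge> 1" "\<forall>x\<in>set v. x \<ge> 1" "\<forall>x\<in>set u'. x \<ge> 1" "\<forall>x\<in>set v'. x \<ge> 1"
      using assms(5-8) by fastforce+
    have N: "N \<ge> 1" unfolding assms(9) by (rule prod_nth_ge_1[OF assms(3) ge_1(1,2)])
    have N': "N' \<ge> 1" unfolding assms(10) by (rule prod_nth_ge_1[OF assms(4) ge_1(3,4)])
    have lam: "lam_u l u v \<in> Zpm" "lam_u l' u' v' \<in> Zpm"
      using lam_u_Zpm[OF _ ge_1(1)] lam_u_Zpm[OF _ ge_1(3)] l l' by simp_all
    obtain \<alpha>1 where \<alpha>1: "\<alpha>1 \<in> Zpm" "kron \<alpha>1 \<alpha> = geom z (i * N * (j * N'))"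
      using extend_lam_to_geom[OF z(1,4,2) assms(3,9) N _ lam(1), of "j * N'"] z N'
      by (auto simp: assms(12))
    obtain \<beta>1 where \<beta>1: "\<beta>1 \<in> Zpm" "kron \<beta>1 \<beta> = geom z (j * N' * (i * N))"
      using extend_lam_to_geom[OF z(1,5,3) assms(4,10) N' _ lam(2), of "i * N"] z N
      by (auto simp: assms(14))
    define M where "M = i * N * (j * N')"
    have M: "M \<ge> 1" "j * N' * (i * N) = M" using z N N' by (simp_all add: M_def)
    obtain C where C: "C 0 = 1" "\<And>n. R C (geom z M) n = 1"
      using ex_geom_complement[OF z(1) M(1)] by blast
    have eq: "X = dilsum \<gamma>1 C"
      if "\<gamma>1 \<in> Zpm" "kron \<gamma>1 \<gamma> = geom z M" "\<gamma> \<in> Zpm" "X \<in> Nm" "\<And>n. R X \<gamma> n = 1" for X \<gamma> \<gamma>1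
    proof (rule dilsum_cancel[OF that(3)])
      show "count (mset \<gamma>) 1 = 1" by (rule R_one_eq_1D(1)[OF that(5,4,3)])
      show "X 0 = 1" using that by (simp add: Nm_def)
      show "dilsum \<gamma>1 C 0 = 1" using R_zero[of \<gamma>1 C] that C by (simp add: dilsum_def Zpm_def)
      have "dilsum (kron \<gamma> \<gamma>1) C = dilsum \<gamma> (dilsum \<gamma>1 C)" using that by (simp add: dilsum_kron)
      then show "R X \<gamma> n = R (dilsum \<gamma>1 C) \<gamma> n" for n
        using that C by (simp add: dilsum_def fun_eq_iff kron_commute[of \<gamma>])
    qed
    have "A = dilsum \<alpha>1 C" using eq[of \<alpha>1 \<alpha> A] \<alpha>1 Zpm Nm repA by (simp add: M_def)
    moreover have "B = dilsum \<beta>1 C" using eq[of \<beta>1 \<beta> B] \<beta>1 Zpm Nm repB M(2) by simp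
    moreover have "kron \<alpha>1 \<alpha> = kron \<beta>1 \<beta>" using \<alpha>1 \<beta>1 M by (simp add: M_def)
    moreover have "(\<alpha>1, \<alpha>) \<noteq> (\<beta>1, \<beta>)"
      using assms(17,18) calculation by (auto simp: trivial_solution_def)
    moreover have "C \<in> Nm" using C by (simp add: Nm_def)
    ultimately show ?thesis
      unfolding first_construction_def using assms(17) \<alpha>1(1) \<beta>1(1) Zpm by blast
  qed
  show ?thesis using i_ii ii_iii iii_i by blast
qed

end
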